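(* Let $f:\mathbb{R}^d\to\mathbb{R}$ be differentiable with minimum value $f^\star=\min_{x} f(x)$, and $L$-smooth: $\|\nabla f(x)-\nabla f(y)\|\le L\|x-y\|$ for all $x,y\in\mathbb{R}^d$. Let $\tau\ge 1$ be an integer and $M,\sigma^2\ge 0$. Let $\{x_t\}_{t\ge0}$ be the iterates of delayed SGD with constant stepsize $\gamma$ and starting point $x_0\in\mathbb{R}^d$: $x_0=x_1=\dots=x_\tau$ and $$x_{t+1}=x_t-\gamma g_{t-\tau}\quad (t\ge\tau),\qquad g_t=\nabla f(x_t)+\xi_t ,$$ where the noise $\xi_t$ is $(M,\sigma^2)$-bounded (see context). Let $T\ge1$ be an integer. Then: (1) If $f$ is $\mu$-quasi-convex with respect to $x^\star$ with $\mu>0$, there exists a stepsize $\gamma\le \frac{1}{10L(\tau+M)}$ (chosen as in rule A of the context) such that $$\mathbb{E} f(x^{\rm out})-f^\star=\tilde{\mathcal O}\left(L(\tau+M)\|x_0-x^\star\|^2\exp\left[-\frac{\mu T}{10L(\tau+M)}\right]+\frac{\sigma^2}{\mu T}\right),$$ where $x^{\rm out}\in\{x_t\}_{t=0}^{T-1}$ is chosen to be $x_t$ with probability proportional to $(1-\mu\gamma/2)^{-t}$. (2) If $f$ is $\mu$-quasi-convex with respect to $x^\star$ with $\mu=0$, there exists a stepsize $\gamma\le\frac{1}{10L(\tau+M)}$ (chosen as in rule B of the context) such that $$\mathbb{E} f(x^{\rm out})-f^\star=\mathcal O\left(\frac{L(\tau+M)\|x_0-x^\star\|^2}{T}+\frac{\sigma\|x_0-x^\star\|}{\sqrt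 T}\right),$$ where $x^{\rm out}$ is chosen uniformly at random from $\{x_t\}_{t=0}^{T-1}$. (3) If $f$ is an arbitrary (possibly non-convex) such function, there exists a stepsize $\gamma\le\frac{1}{10L(\tau+M)}$ (chosen as in rule B of the context) such that $$\mathbb{E}\|\nabla f(x^{\rm out})\|^2=\mathcal O\left(\frac{L(\tau+M)(f(x_0)-f^\star)}{T}+\sigma\sqrt{\frac{L(f(x_0)-f^\star)}{T}}\right),$$ where $x^{\rm out}$ is chosen uniformly at random from $\{x_t\}_{t=0}^{T-1}$.
   Context: $\mu$-quasi-convexity with respect to $x^\star$ ($\mu\ge0$): $f(x)-f^\star+\frac{\mu}{2}\|x-x^\star\|^2\le\langle\nabla f(x),x-x^\star\rangle$ for all $x\in\mathbb{R}^d$ (this forces $x^\star$ to be a minimizer of $f$). $(M,\sigma^2)$-bounded noise: in each gradient $g=\nabla f(x)+\xi$ the noise $\xi$ is conditionally independent (given the query point $x$, independent of the past of the algorithm), with $\mathbb{E}[\xi\mid x]=0$ and $\mathbb{E}[\|\xi\|^2\mid x]\le M\|\nabla f(x)\|^2+\sigma^2$. Stepsize rules, with $d=10L(\tau+M)$. Rule A: $\gamma\le 1/d$ is tuned, depending on the problem parameters and $T$, so as to make $\frac{r_0}{\gamma}\exp[-a\gamma T]+c\gamma$ small, where $a=\mu/2$, $r_0=\|x_0-x^\star\|^2$ and $c$ is a constant multiple of $\sigma^2$. Rule B: $\gamma=\sqrt{r_0/(cT)}$ if this is at most $1/d$, and $\gamma=1/d$ otherwise, where in (2) $r_0=\|x_0-x^\star\|^2$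 and $c$ is a constant multiple of $\sigma^2$, and in (3) $r_0$ is a constant multiple of $f(x_0)-f^\star$ and $c$ a constant multiple of $L\sigma^2$. Expectations are over all randomness, including the choice of $x^{\rm out}$. $\mathcal O(\cdot)$ hides constant factors; $\tilde{\mathcal O}(\cdot)$ hides constants and factors polylogarithmic in the problem parameters.
   Formalization: In (1) the exponential factor is exp[-(μ/2)T/(10L(τ+M))] instead of exp[-μT/(10L(τ+M))]: with the stated sampling weights the literal exponent fails, e.g. for f(x)=x²/2, μ=L=τ=1, M=σ=0, x_0=1, where x_0 is output with probability at least 0.05·0.95^T. *)

theory Defs
  imports "HOL-Probability.Probability"
begin

definition quasi_convex ::
  "('a::euclidean_space \<Rightarrow> real) \<Rightarrow> ('a \<Rightarrow> 'a) \<Rightarrow> real \<Rightarrow> real \<Rightarrow> 'a \<Rightarrow> bool" where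
  "quasi_convex f gradf fstar \<mu> xstar \<longleftrightarrow>
     (\<forall>x. f x - fstar + \<mu> / 2 * (norm (x - xstar))\<^sup>2 \<le> gradf x \<bullet> (x - xstar))"

text \<open>The sub-\<open>\<sigma>\<close>-algebra generated by \<open>\<xi>\<^sub>0, \<dots>, \<xi>\<^sub>t\<^sub>-\<^sub>1\<close>. As the starting point is deterministic, this
  is everything the algorithm has generated when \<open>\<xi>\<^sub>t\<close> is drawn; it contains in particular the
  gradients that have been computed but, because of the delay, have not yet been applied.\<close>

definition noise_past :: "'w measure \<Rightarrow> (nat \<Rightarrow> 'w \<Rightarrow> 'a::euclidean_space) \<Rightarrow> nat \<Rightarrow> 'w measure" where
  "noise_past \<Omega> \<xi> t =
     vimage_algebra (space \<Omega>) (\<lambda>\<omega>. \<lambda>s\<in>{..<t}. \<xi> s \<omega>) (\<Pi>\<^sub>M s\<in>{..<t}. borel)"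

text \<open>Conditional independence, given \<open>G\<close>, of the sub-\<open>\<sigma>\<close>-algebras \<open>F\<close> and \<open>H\<close> of \<open>\<Omega>\<close>.\<close>

definition cond_indep :: "'w measure \<Rightarrow> 'w measure \<Rightarrow> 'w measure \<Rightarrow> 'w measure \<Rightarrow> bool" where
  "cond_indep \<Omega> G F H \<longleftrightarrow>
     (\<forall>A\<in>sets F. \<forall>B\<in>sets H. AE \<omega> in \<Omega>.
        real_cond_exp \<Omega> G (indicator (A \<inter> B)) \<omega> =
        real_cond_exp \<Omega> G (indicator A) \<omega> * real_cond_exp \<Omega> G (indicator B) \<omega>)"

text \<open>\<open>(M, \<sigma>\<^sup>2)\<close>-bounded noise \<open>\<xi>\<close> along query points \<open>x\<close>; conditioning on the point \<open>x\<^sub>t\<close> means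
  conditioning on the \<open>\<sigma>\<close>-algebra generated by the random vector \<open>x\<^sub>t\<close>. The library's \<open>real_cond_exp\<close> is
  real-valued, so the conditional mean of the vector \<open>\<xi>\<^sub>t\<close> is taken coordinatewise. Its
  conditional second moment is formed in \<open>ennreal\<close>, so that it is not a junk value when
  \<open>\<parallel>\<xi>\<^sub>t\<parallel>\<^sup>2\<close> fails to be integrable.\<close>

definition bounded_noise ::
  "'w measure \<Rightarrow> ('a::euclidean_space \<Rightarrow> 'a) \<Rightarrow> real \<Rightarrow> real \<Rightarrow>
   (nat \<Rightarrow> 'w \<Rightarrow> 'a) \<Rightarrow> (nat \<Rightarrow> 'w \<Rightarrow> 'a) \<Rightarrow> bool" where
  "bounded_noise \<Omega> gradf M \<sigma> x \<xi> \<longleftrightarrow>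
     (\<forall>t. let G = vimage_algebra (space \<Omega>) (x t) borel in
        integrable \<Omega> (\<xi> t) \<and>
        cond_indep \<Omega> G (vimage_algebra (space \<Omega>) (\<xi> t) borel) (noise_past \<Omega> \<xi> t) \<and>
        (\<forall>b\<in>Basis. AE \<omega> in \<Omega>. real_cond_exp \<Omega> G (\<lambda>\<omega>'. \<xi> t \<omega>' \<bullet> b) \<omega> = 0) \<and>
        (AE \<omega> in \<Omega>. nn_cond_exp \<Omega> G (\<lambda>\<omega>'. ennreal ((norm (\<xi> t \<omega>'))\<^sup>2)) \<omega>
                     \<le> ennreal (M * (norm (gradf (x t \<omega>)))\<^sup>2 + \<sigma>\<^sup>2)))"

definition delayed_sgd ::
  "'w measure \<Rightarrow> ('a::euclidean_space \<Rightarrow> 'a) \<Rightarrow> real \<Rightarrow> real \<Rightarrow> nat \<Rightarrow> real \<Rightarrow> 'a \<Rightarrow>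
   (nat \<Rightarrow> 'w \<Rightarrow> 'a) \<Rightarrow> (nat \<Rightarrow> 'w \<Rightarrow> 'a) \<Rightarrow> bool" where
  "delayed_sgd \<Omega> gradf M \<sigma> \<tau> \<gamma> x0 x \<xi> \<longleftrightarrow>
     prob_space \<Omega> \<and> bounded_noise \<Omega> gradf M \<sigma> x \<xi> \<and>
     (\<forall>\<omega>\<in>space \<Omega>. \<forall>t\<le>\<tau>. x t \<omega> = x0) \<and>
     (\<forall>\<omega>\<in>space \<Omega>. \<forall>t\<ge>\<tau>.
        x (Suc t) \<omega> = x t \<omega> - \<gamma> *\<^sub>R (gradf (x (t - \<tau>) \<omega>) + \<xi> (t - \<tau>) \<omega>))"

text \<open>A random index \<open>N\<close> in \<open>{0, \<dots>, T - 1}\<close>, independent of the noise sequence (hence of the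
  iterates), taking the value \<open>t\<close> with probability proportional to \<open>w t\<close>. The output point
  is then \<open>\<lambda>\<omega>. x (N \<omega>) \<omega>\<close>.\<close>

definition output_index ::
  "'w measure \<Rightarrow> (nat \<Rightarrow> 'w \<Rightarrow> 'a::euclidean_space) \<Rightarrow> (nat \<Rightarrow> real) \<Rightarrow> nat \<Rightarrow> ('w \<Rightarrow> nat) \<Rightarrow> bool" where
  "output_index \<Omega> \<xi> w T N \<longleftrightarrow>
     N \<in> measurable \<Omega> (count_space UNIV) \<and>
     prob_space.indep_set \<Omega>
       (sets (vimage_algebra (space \<Omega>) N (count_space UNIV)))
       (sets (vimage_algebra (space \<Omega>) (\<lambda>\<omega> t. \<xi> t \<omega>) (\<Pi>\<^sub>M t\<in>UNIV. borel))) \<and>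
     (\<forall>\<omega>\<in>space \<Omega>. N \<omega> < T) \<and>
     (\<forall>t<T. measure \<Omega> {\<omega> \<in> space \<Omega>. N \<omega> = t} = w t / (\<Sum>s<T. w s))"

text \<open>The logarithmic factor arising from tuning \<open>\<gamma>\<close> in \<open>r0 / \<gamma> * exp (- a * \<gamma> * T) + c * \<gamma>\<close>.
  For \<open>c = 0\<close> (no additive noise) its value is \<open>ln 2\<close>.\<close>

definition tuning_log :: "real \<Rightarrow> real \<Rightarrow> real \<Rightarrow> nat \<Rightarrow> real" where
  "tuning_log a c r0 T = ln (max 2 (a\<^sup>2 * r0 * (real T)\<^sup>2 / c))"

text \<open>For \<open>\<gamma> = tuning_log a c r0 T / (a * T)\<close> the two terms of the expression above balance up to
  logarithms; the cap \<open>1 / d\<close> is used if this value exceeds it. If \<open>c = 0\<close> the expression is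
  decreasing in \<open>\<gamma>\<close> and the cap is the best choice.\<close>

definition stepsize_A :: "real \<Rightarrow> real \<Rightarrow> real \<Rightarrow> real \<Rightarrow> nat \<Rightarrow> real" where
  "stepsize_A d a c r0 T =
     (if c = 0 then 1 / d else min (1 / d) (tuning_log a c r0 T / (a * real T)))"

text \<open>The case \<open>c = 0\<close> is separate because there \<open>sqrt (r0 / (c * T))\<close> stands for \<open>\<infinity>\<close>, whereas
  division by zero yields \<open>0\<close> in HOL.\<close>

definition stepsize_B :: "real \<Rightarrow> real \<Rightarrow> real \<Rightarrow> nat \<Rightarrow> real" where
  "stepsize_B d c r0 T =
     (if c \<noteq> 0 \<and> sqrt (r0 / (c * real T)) \<le> 1 / d then sqrt (r0 / (c * real T)) else 1 / d)"

end

theory Submission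
  imports Defs
begin

text \<open>Let \<open>g\<^sub>s = \<nabla>f(x\<^sub>s) + \<xi>\<^sub>s\<close> and consider the virtual iterates \<open>y\<^sub>t = x\<^sub>0 - \<gamma> \<Sum>\<^sub>s\<^sub><\<^sub>t g\<^sub>s\<close>, which apply every
  gradient without delay. They satisfy the usual one-step estimates of SGD (for \<open>\<parallel>y\<^sub>t - x\<^sup>\<star>\<parallel>\<^sup>2\<close> in the
  quasi-convex case, for \<open>f(y\<^sub>t)\<close> in the non-convex one) up to an error of order \<open>\<parallel>x\<^sub>t - y\<^sub>t\<parallel>\<^sup>2\<close>.
  The drift \<open>x\<^sub>t - y\<^sub>t\<close> is \<open>\<gamma>\<close> times the sum of the last \<open>\<tau>\<close> gradients; since the noise terms are
  orthogonal in \<open>L\<^sup>2\<close>, its second moment is at most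
  \<open>2\<gamma>\<^sup>2(\<tau> + M) \<Sum> E\<parallel>\<nabla>f(x\<^sub>s)\<parallel>\<^sup>2 + 2\<gamma>\<^sup>2\<tau>\<sigma>\<^sup>2\<close>, the sum being over that window. After summation over \<open>t\<close> each
  gradient is charged at most \<open>\<tau>\<close> times, and \<open>\<gamma> \<le> 1 / (10L(\<tau> + M))\<close> lets the descent term absorb
  these charges.\<close>

text \<open>The noise is centred given \<open>x t\<close> alone, whereas the inner products that
  must cancel involve the virtual iterate, which also depends on gradients still in transit.
  Conditional independence from \<open>noise_past\<close> upgrades the centring to the whole past;
  every orthogonality below rests on this. Finiteness of second moments has to be established along
  the run before any expectation can be split. In the strongly quasi-convex case the averaging
  weights grow geometrically, so charging a late error to an early gradient costs an extra factor
  \<open>w \<tau>\<close>. It stays below \<open>10 / 9\<close> because \<open>\<mu> \<le> L\<close>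
  and \<open>L * \<gamma> * \<tau> \<le> 1 / 10\<close>. Quasi-convexity speaks of the distance from
  \<open>x t\<close>, the recursion of the distance from the virtual iterate; changing between them
  halves the modulus, whence the contraction \<open>1 - \<mu> * \<gamma> / 2\<close> and the
  exponent with \<open>\<mu> / 2\<close>. Rule B may return the stepsize 0, namely when
  \<open>L = 0\<close> or when its \<open>r0\<close> vanishes; such constant runs are treated
  separately.\<close>

lemma norm_sum_sq_le: "(norm (\<Sum>s\<in>S. v s))\<^sup>2 \<le> real (card S) * (\<Sum>s\<in>S. (norm (v s))\<^sup>2)"
proof -
  have "(norm (\<Sum>s\<in>S. v s))\<^sup>2 \<le> (\<Sum>s\<in>S. norm (v s))\<^sup>2"
    by (intro power_mono norm_sum norm_ge_zero)
  also have "\<dots> \<le> real (card S) * (\<Sum>s\<in>S. (norm (v s))\<^sup>2)"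
    using sum_squared_le_sum_of_squares[of "\<lambda>s. norm (v s)" S] by (simp add: mult.commute)
  finally show ?thesis .
qed

lemma norm_add_sq_le: "(norm (u + v))\<^sup>2 \<le> 2 * (norm u)\<^sup>2 + 2 * (norm v)\<^sup>2"
  for u v :: "'a::real_inner"
proof -
  have "(norm (u + v))\<^sup>2 + (norm (u - v))\<^sup>2 = 2 * (norm u)\<^sup>2 + 2 * (norm v)\<^sup>2"
    by (simp add: power2_norm_eq_inner algebra_simps inner_commute)
  then show ?thesis by (smt (verit) zero_le_power2)
qed

subsection \<open>Smooth functions\<close>

locale smooth_function =
  fixes f :: "'a::euclidean_space \<Rightarrow> real" and gradf :: "'a \<Rightarrow> 'a" and fstar L :: real
  assumes gradient: "\<And>x. GDERIV f x :> gradf x"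
    and lower_bound: "\<And>x. fstar \<le> f x"
    and smooth: "\<And>x y. norm (gradf x - gradf y) \<le> L * norm (x - y)"
begin

lemma smoothness_const_nonneg: "0 \<le> L"
proof -
  obtain b :: 'a where "b \<in> Basis" using nonempty_Basis by blast
  then show ?thesis
    using smooth[of b 0] order_trans[OF norm_ge_zero[of "gradf b - gradf 0"], of L] by simp
qed

text \<open>Along the segment, \<open>p\<close> is the gap between \<open>f\<close> and its
  quadratic model. Cauchy-Schwarz and the Lipschitz bound on the gradient make its derivative
  nonpositive, so monotonicity of \<open>p\<close> replaces integrating the gradient.\<close>

lemma descent: "f y \<le> f x + gradf x \<bullet> (y - x) + L / 2 * (norm (y - x))\<^sup>2"
proof -
  define d where "d = y - x"
  define p where "p = (\<lambda>t. f (x + t *\<^sub>R d) - t * (gradf x \<bullet> d) - L / 2 * t\<^sup>2 * (norm d)\<^sup>2)"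
  have "p 1 \<le> p 0"
  proof (rule DERIV_nonpos_imp_nonincreasing[of 0 1 p])
    fix t :: real assume t: "0 \<le> t" "t \<le> 1"
    have "(f has_derivative (\<lambda>h. h \<bullet> gradf (x + t *\<^sub>R d))) (at (x + t *\<^sub>R d))"
      using gradient unfolding gderiv_def by blast
    then have "((\<lambda>t. f (x + t *\<^sub>R d)) has_derivative (\<lambda>h. (h *\<^sub>R d) \<bullet> gradf (x + t *\<^sub>R d))) (at t)"
      by (rule has_derivative_compose[rotated]) (auto intro!: derivative_eq_intros)
    then have "((\<lambda>t. f (x + t *\<^sub>R d)) has_field_derivative (gradf (x + t *\<^sub>R d) \<bullet> d)) (at t)"
      unfolding has_field_derivative_def
      by (rule has_derivative_eq_rhs) (auto simp: inner_commute mult.commute)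
    then have "(p has_field_derivative
        (gradf (x + t *\<^sub>R d) \<bullet> d - gradf x \<bullet> d - L * t * (norm d)\<^sup>2)) (at t)"
      unfolding p_def by (auto intro!: derivative_eq_intros)
    moreover have "(gradf (x + t *\<^sub>R d) - gradf x) \<bullet> d \<le> L * norm (t *\<^sub>R d) * norm d"
      using norm_cauchy_schwarz[of "gradf (x + t *\<^sub>R d) - gradf x" d]
        mult_right_mono[OF smooth[of "x + t *\<^sub>R d" x] norm_ge_zero[of d]] by simp
    ultimately show "\<exists>y. DERIV p t :> y \<and> y \<le> 0"
      using t by (auto simp: inner_diff_left power2_eq_square intro!: exI)
  qed simp
  then show ?thesis by (simp add: p_def d_def)
qed

text \<open>A gradient step of length \<open>1 / K\<close> still ends at a value of at least
  \<open>fstar\<close>, which limits the descent that the gradient can promise. A free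
  \<open>K\<close> above \<open>L\<close> keeps the bound usable for \<open>L = 0\<close>, where
  \<open>K\<close> can be sent to zero.\<close>

lemma norm_gradient_sq_le:
  assumes "L \<le> K" "0 < K"
  shows "(norm (gradf x))\<^sup>2 \<le> 2 * K * (f x - fstar)"
proof -
  interpret K: smooth_function f gradf fstar K
    using gradient lower_bound order_trans[OF smooth mult_right_mono[OF assms(1) norm_ge_zero]]
    by unfold_locales
  have "fstar \<le> f x - (1/K) * (norm (gradf x))\<^sup>2 + K / 2 * (1/K)\<^sup>2 * (norm (gradf x))\<^sup>2"
    using lower_bound[of "x - (1/K) *\<^sub>R gradf x"] K.descent[of "x - (1/K) *\<^sub>R gradf x" x]
    by (simp add: power_mult_distrib power2_norm_eq_inner power_divide)
  also have "\<dots> = f x - (norm (gradf x))\<^sup>2 / (2 * K)"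
    using assms by (simp add: field_simps power2_eq_square)
  finally show ?thesis using assms by (simp add: field_simps)
qed

text \<open>This serves the runs with stepsize 0. At the value \<open>fstar\<close> the preceding
  bound vanishes for every admissible \<open>K\<close>; for \<open>L = 0\<close> the choice
  \<open>K = e / (2 * c)\<close> makes it equal to an arbitrary \<open>e\<close>.\<close>

lemma gradient_zero:
  assumes "f x = fstar \<or> L = 0"
  shows "gradf x = 0"
proof -
  have "(norm (gradf x))\<^sup>2 \<le> 0"
  proof (cases "f x = fstar")
    case True
    then show ?thesis
      using norm_gradient_sq_le[of "L + 1" x] smoothness_const_nonneg by simp
  next
    case False
    define c where "c = f x - fstar"
    have c: "0 < c" "L = 0" using False lower_bound[of x] assms by (auto simp: c_def less_le)
    show ?thesis
    proof (rule field_le_epsilon)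
      fix e :: real assume "0 < e"
      then show "(norm (gradf x))\<^sup>2 \<le> 0 + e"
        using norm_gradient_sq_le[of "e / (2 * c)" x] c by (simp flip: c_def)
    qed
  qed
  then show ?thesis by simp
qed

text \<open>At unit distance from \<open>xstar\<close>, quasi-convexity bounds the gradient norm
  below by the gap plus \<open>\<mu> / 2\<close>, while the inequality of means and
  \<open>norm_gradient_sq_le\<close> bound it above by the gap plus \<open>L / 2\<close>; the gap
  cancels.\<close>

lemma quasi_convex_const_le:
  assumes "quasi_convex f gradf fstar \<mu> xstar" "0 < L"
  shows "\<mu> \<le> L"
proof -
  obtain b :: 'a where b: "b \<in> Basis" using nonempty_Basis by blast
  define x where "x = xstar + b"
  have "f x - fstar + \<mu> / 2 \<le> gradf x \<bullet> b"
    using assms b by (auto simp: quasi_convex_def x_def dest: spec[of _ "xstar + b"])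
  also have "\<dots> \<le> norm (gradf x)"
    using norm_cauchy_schwarz[of "gradf x" b] b by simp
  also have "\<dots> \<le> (norm (gradf x))\<^sup>2 / (2 * L) + L / 2"
    using assms(2) zero_le_power2[of "norm (gradf x) - L"]
    by (simp add: field_simps power2_eq_square)
  also have "\<dots> \<le> f x - fstar + L / 2"
    using norm_gradient_sq_le[of L x] assms(2) by (simp add: field_simps)
  finally show ?thesis by simp
qed

lemma gradient_continuous: "continuous_on UNIV gradf"
  using smoothness_const_nonneg
  by (intro lipschitz_on_continuous_on[of L] lipschitz_onI) (auto simp: dist_norm intro: smooth)

lemma gradient_borel_measurable [measurable]: "gradf \<in> borel_measurable borel"
  by (rule borel_measurable_continuous_onI[OF gradient_continuous])

lemma borel_measurable_f [measurable]: "f \<in> borel_measurable borel"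
proof (rule borel_measurable_continuous_onI)
  show "continuous_on UNIV f"
    using gradient unfolding gderiv_def
    by (intro differentiable_imp_continuous_on differentiable_at_imp_differentiable_on)
      (auto simp: differentiable_def)
qed

end

subsection \<open>Square integrability and conditional independence\<close>

context finite_measure
begin

definition square_integrable :: "('a \<Rightarrow> 'b::euclidean_space) \<Rightarrow> bool" where
  "square_integrable X \<longleftrightarrow> X \<in> borel_measurable M \<and> integrable M (\<lambda>\<omega>. (norm (X \<omega>))\<^sup>2)"

lemma square_integrable_measurable: "square_integrable X \<Longrightarrow> X \<in> borel_measurable M"
  by (simp add: square_integrable_def)

lemma square_integrable_norm_sq: "square_integrable X \<Longrightarrow> integrable M (\<lambda>\<omega>. (norm (X \<omega>))\<^sup>2)"
  by (simp add: square_integrable_def)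

lemma square_integrable_le:
  assumes "integrable M h" "X \<in> borel_measurable M"
    and "\<And>\<omega>. \<omega> \<in> space M \<Longrightarrow> (norm (X \<omega>))\<^sup>2 \<le> h \<omega>"
  shows "square_integrable X"
  unfolding square_integrable_def
proof
  show "integrable M (\<lambda>\<omega>. (norm (X \<omega>))\<^sup>2)"
    using assms(2)
    by (intro Bochner_Integration.integrable_bound[OF assms(1)])
      (auto intro!: AE_I2 order_trans[OF assms(3)])
qed fact

lemma square_integrable_const: "square_integrable (\<lambda>_. c)"
  by (simp add: square_integrable_def)

lemma square_integrable_add:
  assumes "square_integrable X" "square_integrable Y"
  shows "square_integrable (\<lambda>\<omega>. X \<omega> + Y \<omega>)"
proof (rule square_integrable_le)
  show "integrable M (\<lambda>\<omega>. 2 * (norm (X \<omega>))\<^sup>2 + 2 * (norm (Y \<omega>))\<^sup>2)"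
    using assms by (simp add: square_integrable_def)
  show "(\<lambda>\<omega>. X \<omega> + Y \<omega>) \<in> borel_measurable M"
    using assms by (auto simp: square_integrable_def)
  show "(norm (X \<omega> + Y \<omega>))\<^sup>2 \<le> 2 * (norm (X \<omega>))\<^sup>2 + 2 * (norm (Y \<omega>))\<^sup>2" for \<omega>
    by (rule norm_add_sq_le)
qed

lemma square_integrable_scaleR:
  assumes "square_integrable X"
  shows "square_integrable (\<lambda>\<omega>. c *\<^sub>R X \<omega>)"
  using assms by (auto simp: square_integrable_def power_mult_distrib)

lemma square_integrable_diff:
  assumes "square_integrable X" "square_integrable Y"
  shows "square_integrable (\<lambda>\<omega>. X \<omega> - Y \<omega>)"
  using square_integrable_add[OF assms(1) square_integrable_scaleR[OF assms(2), of "-1"]] by simp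

lemma square_integrable_sum:
  assumes "\<And>s. s \<in> S \<Longrightarrow> square_integrable (X s)"
  shows "square_integrable (\<lambda>\<omega>. \<Sum>s\<in>S. X s \<omega>)"
  using assms
  by (induction S rule: infinite_finite_induct)
    (auto intro: square_integrable_add simp: square_integrable_const)

lemma square_integrable_inner:
  assumes "square_integrable X" "square_integrable Y"
  shows "integrable M (\<lambda>\<omega>. X \<omega> \<bullet> Y \<omega>)"
proof -
  have "integrable M (\<lambda>\<omega>. (norm (X \<omega> + Y \<omega>))\<^sup>2 - (norm (X \<omega>))\<^sup>2 - (norm (Y \<omega>))\<^sup>2)"
    using square_integrable_add[OF assms] assms by (simp add: square_integrable_def)
  then have "integrable M (\<lambda>\<omega>. 2 * (X \<omega> \<bullet> Y \<omega>))"
    by (simp add: power2_norm_eq_inner algebra_simps inner_commute)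
  then show ?thesis by simp
qed

lemmas square_integrable_intros =
  square_integrable_const square_integrable_add square_integrable_diff
  square_integrable_scaleR square_integrable_sum

lemma subalgebra_vimage_algebra:
  assumes "X \<in> measurable M N"
  shows "subalgebra M (vimage_algebra (space M) X N)"
  using assms by (auto simp: subalgebra_def sets_vimage_algebra2 measurable_def)

end

context prob_space
begin

text \<open>Writing \<open>p = E[1\<^sub>B | G]\<close>, conditional independence says exactly that \<open>1\<^sub>B\<close> and \<open>p\<close> have the same
  conditional expectation given \<open>F\<close>; for an \<open>F\<close>-measurable \<open>X\<close> this gives
  \<open>E[X 1\<^sub>B] = E[X p] = E[E[X | G] p]\<close>.\<close>

lemma cond_indep_cond_exp_zero:
  fixes X :: "'a \<Rightarrow> real"
  assumes sub: "subalgebra M G" "subalgebra M F" "subalgebra M H"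
    and ci: "cond_indep M G F H"
    and X: "integrable M X" "X \<in> borel_measurable F"
    and zero: "AE \<omega> in M. real_cond_exp M G X \<omega> = 0"
  shows "AE \<omega> in M. real_cond_exp M H X \<omega> = 0"
proof -
  interpret G: finite_measure_subalgebra M G by unfold_locales fact
  interpret F: finite_measure_subalgebra M F by unfold_locales fact
  interpret H: finite_measure_subalgebra M H by unfold_locales fact
  have XM[measurable]: "X \<in> borel_measurable M" using X(1) by simp
  have "(\<integral>\<omega>\<in>B. X \<omega> \<partial>M) = (\<integral>\<omega>\<in>B. 0 \<partial>M)" if B: "B \<in> sets H" for B
  proof -
    have BM[measurable]: "B \<in> sets M" using B sub(3) by (auto simp: subalgebra_def)
    define p where "p = real_cond_exp M G (indicator B)"
    have iB: "integrable M (indicator B :: 'a \<Rightarrow> real)"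
      by (rule integrable_real_indicator) (auto simp: less_top[symmetric])
    have p_int: "integrable M p" unfolding p_def by (rule G.real_cond_exp_int(1)[OF iB])
    have p_G: "p \<in> borel_measurable G" unfolding p_def by simp
    have [measurable]: "p \<in> borel_measurable M" using p_int by simp
    \<comment> \<open>Boundedness of \<open>p\<close> is what makes \<open>X * p\<close> integrable
      when \<open>X\<close> is merely integrable.\<close>
    have p_bound: "AE \<omega> in M. \<bar>p \<omega>\<bar> \<le> 1"
    proof -
      have "AE \<omega> in M. 0 \<le> p \<omega>" unfolding p_def
        by (rule G.real_cond_exp_ge_c[OF iB]) auto
      moreover have "AE \<omega> in M. p \<omega> \<le> 1" unfolding p_def
        by (rule G.real_cond_exp_le_c[OF iB]) (auto simp: indicator_def)
      ultimately show ?thesis by eventually_elim simp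
    qed
    have "AE \<omega> in M. real_cond_exp M F (indicator B) \<omega> = real_cond_exp M F p \<omega>"
    proof (rule F.real_cond_exp_charact)
      fix A assume A: "A \<in> sets F"
      then have AM[measurable]: "A \<in> sets M" using sub(2) by (auto simp: subalgebra_def)
      have pA: "integrable M (\<lambda>\<omega>. p \<omega> * indicator A \<omega>)"
        using integrable_mult_indicator[OF AM p_int] by (simp add: mult.commute)
      have iAB: "integrable M (indicator (A \<inter> B) :: 'a \<Rightarrow> real)"
        by (rule integrable_real_indicator) (auto simp: less_top[symmetric])
      have "(\<integral>\<omega>\<in>A. indicator B \<omega> \<partial>M) = (\<integral>\<omega>. indicator (A \<inter> B) \<omega> \<partial>M)"
        unfolding set_lebesgue_integral_def
        by (intro Bochner_Integration.integral_cong) (auto simp: indicator_def)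
      also have "\<dots> = (\<integral>\<omega>. real_cond_exp M G (indicator (A \<inter> B)) \<omega> \<partial>M)"
        by (rule G.real_cond_exp_int(2)[OF iAB, symmetric])
      also have "\<dots> = (\<integral>\<omega>. p \<omega> * real_cond_exp M G (indicator A) \<omega> \<partial>M)"
        using ci A B by (intro integral_cong_AE) (auto simp: cond_indep_def p_def mult.commute)
      also have "\<dots> = (\<integral>\<omega>. p \<omega> * indicator A \<omega> \<partial>M)"
        by (rule G.real_cond_exp_intg(2)[OF pA p_G]) simp
      also have "\<dots> = (\<integral>\<omega>\<in>A. p \<omega> \<partial>M)"
        by (simp add: set_lebesgue_integral_def mult.commute)
      also have "\<dots> = (\<integral>\<omega>\<in>A. real_cond_exp M F p \<omega> \<partial>M)"
        by (rule F.real_cond_exp_intA[OF p_int A])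
      finally show "(\<integral>\<omega>\<in>A. indicator B \<omega> \<partial>M) = (\<integral>\<omega>\<in>A. real_cond_exp M F p \<omega> \<partial>M)" .
    qed (auto intro: F.real_cond_exp_int(1)[OF p_int] iB)
    note p_F = this
    have XB: "integrable M (\<lambda>\<omega>. X \<omega> * indicator B \<omega>)"
      using integrable_mult_indicator[OF BM X(1)] by (simp add: mult.commute)
    have Xp: "integrable M (\<lambda>\<omega>. X \<omega> * p \<omega>)"
      by (rule Bochner_Integration.integrable_bound[OF X(1)])
        (use p_bound in \<open>auto simp: abs_mult mult_left_le elim!: eventually_mono\<close>)
    have "(\<integral>\<omega>\<in>B. X \<omega> \<partial>M) = (\<integral>\<omega>. X \<omega> * indicator B \<omega> \<partial>M)"
      by (simp add: set_lebesgue_integral_def mult.commute)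
    also have "\<dots> = (\<integral>\<omega>. X \<omega> * real_cond_exp M F (indicator B) \<omega> \<partial>M)"
      by (rule F.real_cond_exp_intg(2)[OF XB X(2), symmetric]) simp
    also have "\<dots> = (\<integral>\<omega>. X \<omega> * real_cond_exp M F p \<omega> \<partial>M)"
      using p_F by (intro integral_cong_AE) auto
    also have "\<dots> = (\<integral>\<omega>. p \<omega> * X \<omega> \<partial>M)"
      using F.real_cond_exp_intg(2)[OF Xp X(2)] by (simp add: mult.commute)
    also have "\<dots> = (\<integral>\<omega>. p \<omega> * real_cond_exp M G X \<omega> \<partial>M)"
      using Xp by (intro G.real_cond_exp_intg(2)[symmetric] p_G) (auto simp: mult.commute)
    also have "\<dots> = (\<integral>\<omega>. 0 \<partial>M)"
      using zero by (intro integral_cong_AE) (auto elim: eventually_mono)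
    finally show ?thesis by (simp add: set_lebesgue_integral_def)
  qed
  then show ?thesis by (rule H.real_cond_exp_charact) (auto simp: X)
qed

text \<open>Independence says that the indicator of \<open>A\<close> and the constant
  \<open>prob A\<close> have equal integrals over every set of \<open>H\<close>; hence conditioning
  on \<open>H\<close> replaces one by the other. This later decouples the output index from the
  iterates.\<close>

lemma indep_set_integral_indicator_mult:
  fixes h :: "'a \<Rightarrow> real"
  assumes indep: "indep_set \<A> (sets H)" and sub: "subalgebra M H" and A: "A \<in> \<A>"
    and h: "integrable M h" "h \<in> borel_measurable H"
  shows "(\<integral>\<omega>. h \<omega> * indicator A \<omega> \<partial>M) = prob A * (\<integral>\<omega>. h \<omega> \<partial>M)"
proof -
  interpret H: finite_measure_subalgebra M H by unfold_locales fact
  have AM[measurable]: "A \<in> sets M" using indep_setD_ev1[OF indep] A by auto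
  have [measurable]: "h \<in> borel_measurable M" using h by simp
  have "AE \<omega> in M. real_cond_exp M H (indicator A) \<omega> = prob A"
  proof (rule H.real_cond_exp_charact)
    fix B assume B: "B \<in> sets H"
    then have [measurable]: "B \<in> sets M" using sub by (auto simp: subalgebra_def)
    have "(\<integral>\<omega>\<in>B. indicator A \<omega> \<partial>M) = prob (A \<inter> B)"
      by (simp add: set_lebesgue_integral_def Int_commute flip: indicator_inter_arith)
    then show "(\<integral>\<omega>\<in>B. indicator A \<omega> \<partial>M) = (\<integral>\<omega>\<in>B. prob A \<partial>M)"
      using indep_setD[OF indep A B] by (simp add: set_lebesgue_integral_def mult.commute)
  qed (auto intro!: integrable_real_indicator simp: less_top[symmetric])
  then have eq: "(\<integral>\<omega>. h \<omega> * real_cond_exp M H (indicator A) \<omega> \<partial>M) = (\<integral>\<omega>. h \<omega> * prob A \<partial>M)"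
    by (intro integral_cong_AE) (auto elim: eventually_mono)
  have "integrable M (\<lambda>\<omega>. h \<omega> * indicator A \<omega>)"
    using integrable_mult_indicator[OF AM h(1)] by (simp add: mult.commute)
  from H.real_cond_exp_intg(2)[OF this h(2)] eq show ?thesis by (simp add: mult.commute)
qed

end

subsection \<open>One-step estimates and delayed recursions\<close>

context smooth_function
begin

text \<open>Here \<open>z\<close> stands for the virtual iterate and \<open>y\<close> for the point
  where the gradient is taken. The summand
  \<open>\<gamma>\<^sup>2 * M * (norm (gradf y))\<^sup>2\<close> on the left is the multiplicative
  part of the noise variance, included so that the stepsize cap absorbs it together with the squared
  step.\<close>

lemma quasi_convex_step:
  assumes qc: "quasi_convex f gradf fstar \<mu> xstar"
    and L: "0 < L" and \<mu>: "0 \<le> \<mu>" and \<gamma>: "0 \<le> \<gamma>" "10 * L * \<gamma> * (1 + M) \<le> 1" and M: "0 \<le> M"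
  shows "(norm (z - xstar - \<gamma> *\<^sub>R gradf y))\<^sup>2 + \<gamma>\<^sup>2 * M * (norm (gradf y))\<^sup>2
    \<le> (1 - \<mu> * \<gamma> / 2) * (norm (z - xstar))\<^sup>2 - 4 / 5 * \<gamma> * (f y - fstar) + 3 * L * \<gamma> * (norm (y - z))\<^sup>2"
proof -
  define G where "G = (norm (gradf y))\<^sup>2"
  define F where "F = f y - fstar"
  define E where "E = (norm (y - z))\<^sup>2"
  define R where "R = (norm (z - xstar))\<^sup>2"
  define Y where "Y = (norm (y - xstar))\<^sup>2"
  have F0: "0 \<le> F" using lower_bound[of y] by (simp add: F_def)
  have E0: "0 \<le> E" by (simp add: E_def)
  have G: "G \<le> 2 * L * F" using norm_gradient_sq_le[of L y] L by (simp add: G_def F_def)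
  \<comment> \<open>Young's inequality with weight \<open>2 * L\<close>: with
    \<open>G \<le> 2 * L * F\<close>, the cross term then uses up exactly one of the two copies of
    \<open>F\<close> that quasi-convexity supplies.\<close>
  have "0 \<le> (norm (gradf y - (2 * L) *\<^sub>R (y - z)))\<^sup>2" by simp
  then have cross: "4 * L * (gradf y \<bullet> (y - z)) \<le> G + 4 * L\<^sup>2 * E"
    unfolding G_def E_def power2_norm_eq_inner
    by (simp add: algebra_simps inner_commute power2_eq_square)
  also have "\<dots> \<le> 2 * L * F + 4 * L\<^sup>2 * E" using G by simp
  also have "\<dots> = 2 * L * (F + 2 * L * E)" by (simp add: algebra_simps power2_eq_square)
  finally have cross: "2 * (gradf y \<bullet> (y - z)) \<le> F + 2 * L * E" using L by simp
  have "F + \<mu> / 2 * Y \<le> gradf y \<bullet> (y - xstar)"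
    using qc by (simp add: quasi_convex_def F_def Y_def)
  \<comment> \<open>Quasi-convexity yields \<open>\<mu> * Y\<close> after doubling, of which only
    \<open>\<mu> / 2 * R\<close> survives the passage from \<open>y\<close> to \<open>z\<close>. The
    loss \<open>\<mu> * E \<le> L * E\<close> joins the \<open>2 * L * E\<close> of the cross term,
    which explains the coefficient 3.\<close>
  moreover have "\<mu> / 2 * R \<le> \<mu> / 2 * (2 * Y + 2 * E)"
    using norm_add_sq_le[of "y - xstar" "z - y"] \<mu>
    by (intro mult_left_mono) (simp_all add: R_def Y_def E_def norm_minus_commute)
  moreover have "\<mu> * E \<le> L * E"
    using quasi_convex_const_le[OF qc L] E0 by (rule mult_right_mono)
  moreover have "gradf y \<bullet> (z - xstar) = gradf y \<bullet> (y - xstar) - gradf y \<bullet> (y - z)"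
    by (simp add: inner_diff_right)
  ultimately have inner: "F + \<mu> / 2 * R - 3 * L * E \<le> 2 * (gradf y \<bullet> (z - xstar))"
    using cross by (simp add: algebra_simps)
  have "\<gamma> * (1 + M) * G \<le> \<gamma> * (1 + M) * (2 * L * F)"
    using G \<gamma> M by (intro mult_left_mono) auto
  also have "\<dots> = 10 * L * \<gamma> * (1 + M) * F / 5" by simp
  also have "\<dots> \<le> 1 * F / 5" using \<gamma> F0 by (intro divide_right_mono mult_right_mono) auto
  finally have "\<gamma> * (1 + M) * G \<le> F / 5" by simp
  \<comment> \<open>Of the remaining copy of \<open>F\<close> the squared step and the noise take
    one fifth; this leaves \<open>4 / 5\<close>.\<close>
  with inner have "\<gamma> * (1 + M) * G - 2 * (gradf y \<bullet> (z - xstar))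
      \<le> - (\<mu> / 2) * R - 4 / 5 * F + 3 * L * E" by simp
  from mult_left_mono[OF this \<gamma>(1)]
  have "R - 2 * \<gamma> * (gradf y \<bullet> (z - xstar)) + \<gamma>\<^sup>2 * G + \<gamma>\<^sup>2 * M * G
      \<le> (1 - \<mu> * \<gamma> / 2) * R - 4 / 5 * \<gamma> * F + 3 * L * \<gamma> * E"
    by (simp add: algebra_simps power2_eq_square)
  moreover have "(norm (z - xstar - \<gamma> *\<^sub>R gradf y))\<^sup>2
      = R - 2 * \<gamma> * (gradf y \<bullet> (z - xstar)) + \<gamma>\<^sup>2 * G"
    unfolding G_def R_def power2_norm_eq_inner
    by (simp add: algebra_simps inner_commute power2_eq_square)
  ultimately show ?thesis by (simp add: G_def F_def E_def R_def)
qed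

text \<open>Polarization bounds the inner product of the two gradients below by half of the squared
  gradient at \<open>y\<close> minus a drift term, after discarding the squared gradient at
  \<open>z\<close>. The second-order term takes at most \<open>1 / 20\<close>, and
  \<open>1 / 2 - 1 / 20 = 9 / 20\<close>.\<close>

lemma nonconvex_step:
  assumes L: "0 < L" and \<gamma>: "0 \<le> \<gamma>" "10 * L * \<gamma> * (1 + M) \<le> 1"
  shows "f z - \<gamma> * (gradf z \<bullet> gradf y) + L / 2 * \<gamma>\<^sup>2 * (1 + M) * (norm (gradf y))\<^sup>2
    \<le> f z - 9 / 20 * \<gamma> * (norm (gradf y))\<^sup>2 + L\<^sup>2 / 2 * \<gamma> * (norm (y - z))\<^sup>2"
proof -
  define G where "G = (norm (gradf y))\<^sup>2"
  have "(norm (gradf y - gradf z))\<^sup>2 \<le> (L * norm (y - z))\<^sup>2"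
    by (intro power_mono smooth norm_ge_zero)
  then have "G - 2 * (gradf z \<bullet> gradf y) \<le> L\<^sup>2 * (norm (y - z))\<^sup>2 - (norm (gradf z))\<^sup>2"
    by (simp add: G_def power2_norm_eq_inner algebra_simps inner_commute)
  also have "\<dots> \<le> L\<^sup>2 * (norm (y - z))\<^sup>2" by simp
  finally have a: "G - 2 * (gradf z \<bullet> gradf y) \<le> L\<^sup>2 * (norm (y - z))\<^sup>2" .
  have "10 * L * \<gamma> * (1 + M) * G \<le> 1 * G"
    using \<gamma> by (intro mult_right_mono) (auto simp: G_def)
  with a have "L / 2 * \<gamma> * (1 + M) * G - gradf z \<bullet> gradf y
      \<le> - (9 / 20) * G + L\<^sup>2 / 2 * (norm (y - z))\<^sup>2" by (simp add: field_simps)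
  from mult_left_mono[OF this \<gamma>(1)] show ?thesis
    unfolding G_def by (simp add: field_simps power2_eq_square)
qed

end

lemma window_sum_le:
  fixes c :: "nat \<Rightarrow> real"
  assumes "\<And>s. 0 \<le> c s"
  shows "(\<Sum>t<T. \<Sum>s\<in>{t-\<tau>..<t}. c s) \<le> real \<tau> * (\<Sum>s<T. c s)"
proof -
  have "(\<Sum>t<T. \<Sum>s\<in>{t-\<tau>..<t}. c s) = (\<Sum>t<T. \<Sum>s\<in>{s. s \<in> {..<T} \<and> s < t \<and> t \<le> s + \<tau>}. c s)"
    by (intro sum.cong) auto
  also have "\<dots> = (\<Sum>s<T. \<Sum>t\<in>{t. t \<in> {..<T} \<and> s < t \<and> t \<le> s + \<tau>}. c s)"
    by (rule sum.swap_restrict) auto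
  also have "\<dots> \<le> (\<Sum>s<T. \<Sum>t\<in>{s<..s+\<tau>}. c s)"
    using assms by (intro sum_mono sum_mono2) auto
  finally show ?thesis by (simp add: sum_distrib_left)
qed

text \<open>The weights solve \<open>w (Suc t) * (1 - a) = w t\<close>, so the weighted recursion
  telescopes. Reordering the double sum charges each \<open>Q s\<close> with at most
  \<open>r * \<tau> * w \<tau>\<close>, which is paid out of \<open>p\<close>;
  \<open>\<kappa>\<close> is what remains. With \<open>a = 0\<close> the average is uniform.\<close>

lemma delayed_recursion:
  fixes V Q :: "nat \<Rightarrow> real" and a p q r \<kappa> :: real
  defines "w \<equiv> \<lambda>t. inverse (1 - a) ^ t"
  assumes rec: "\<And>t. V (Suc t) \<le> (1 - a) * V t - p * Q t + q + r * (\<Sum>s\<in>{t-\<tau>..<t}. Q s)"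
    and V: "\<And>t. 0 \<le> V t" and Q: "\<And>t. 0 \<le> Q t"
    and a: "0 \<le> a" "a < 1" and r: "0 \<le> r"
    and \<kappa>: "\<kappa> + r * \<tau> * w \<tau> \<le> p" "0 < \<kappa>" and T: "1 \<le> T"
  shows "(\<Sum>t<T. w t / (\<Sum>s<T. w s) * Q t) \<le> (V 0 / (\<Sum>t<T. w (Suc t)) + q) / \<kappa>"
proof -
  have w0: "0 < w t" for t using a by (simp add: w_def)
  have w_Suc: "w (Suc t) = inverse (1 - a) * w t" for t by (simp add: w_def)
  have w_mono: "w s \<le> w t" if "s \<le> t" for s t
    unfolding w_def using a that by (intro power_increasing) (auto simp: one_le_inverse_iff)
  have w_add: "w (s + t) = w s * w t" for s t by (simp add: w_def power_add)
  define D where "D = (\<lambda>t. - p * Q t + q + r * (\<Sum>s\<in>{t-\<tau>..<t}. Q s))"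
  define c where "c = (\<lambda>s. w (Suc s) * Q s)"
  have c0: "0 \<le> c s" for s using w0[of "Suc s"] Q[of s] by (simp add: c_def)
  define W where "W = (\<Sum>t<T. w (Suc t))"
  have W0: "0 < W" unfolding W_def using w0 T by (intro sum_pos) (auto simp: lessThan_empty_iff)
  \<comment> \<open>The contraction has disappeared in this unrolled form, so the nonnegativity of
    \<open>V T\<close> alone bounds the weighted sum of the \<open>D t\<close>.\<close>
  have "w n * V n \<le> V 0 + (\<Sum>t<n. w (Suc t) * D t)" for n
  proof (induction n)
    case 0
    then show ?case by (simp add: w_def)
  next
    case (Suc n)
    have "w (Suc n) * V (Suc n) \<le> w (Suc n) * ((1 - a) * V n + D n)"
      using rec[of n] w0[of "Suc n"] by (intro mult_left_mono) (auto simp: D_def)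
    also have "\<dots> = w n * V n + w (Suc n) * D n"
      using a by (simp add: w_Suc field_simps)
    finally show ?case using Suc by simp
  qed
  from this[of T] have "0 \<le> V 0 + (\<Sum>t<T. w (Suc t) * D t)"
    using V[of T] w0[of T] by (smt (verit) mult_nonneg_nonneg)
  also have "(\<Sum>t<T. w (Suc t) * D t)
      = - p * (\<Sum>t<T. c t) + q * W + r * (\<Sum>t<T. \<Sum>s\<in>{t-\<tau>..<t}. w (Suc t) * Q s)"
  proof -
    have "w (Suc t) * D t = - p * c t + q * w (Suc t) + r * (\<Sum>s\<in>{t-\<tau>..<t}. w (Suc t) * Q s)" for t
      by (simp add: D_def c_def sum_distrib_left algebra_simps)
    then show ?thesis by (simp only: W_def sum.distrib sum_distrib_left[symmetric])
  qed
  also have "(\<Sum>t<T. \<Sum>s\<in>{t-\<tau>..<t}. w (Suc t) * Q s) \<le> (\<Sum>t<T. \<Sum>s\<in>{t-\<tau>..<t}. w \<tau> * c s)"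
  proof (intro sum_mono)
    fix t s assume "s \<in> {t-\<tau>..<t}"
    \<comment> \<open>An index in the window satisfies \<open>t \<le> s + \<tau>\<close>; moving the
      weight from \<open>t\<close> back to \<open>s\<close> thus costs at most one factor
      \<open>w \<tau>\<close>.\<close>
    then have "w (Suc t) \<le> w (\<tau> + Suc s)" by (intro w_mono) auto
    then show "w (Suc t) * Q s \<le> w \<tau> * c s"
      using Q[of s] unfolding c_def w_add mult.assoc[symmetric] by (intro mult_right_mono)
  qed
  also have "\<dots> = w \<tau> * (\<Sum>t<T. \<Sum>s\<in>{t-\<tau>..<t}. c s)" by (simp add: sum_distrib_left)
  also have "\<dots> \<le> w \<tau> * (real \<tau> * (\<Sum>s<T. c s))"
    using w0[of \<tau>] by (intro mult_left_mono window_sum_le c0) auto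
  finally have "(p - r * \<tau> * w \<tau>) * (\<Sum>t<T. c t) \<le> V 0 + q * W"
    using r by (simp add: algebra_simps mult_right_mono)
  moreover have "\<kappa> * (\<Sum>t<T. c t) \<le> (p - r * \<tau> * w \<tau>) * (\<Sum>t<T. c t)"
    using \<kappa> by (intro mult_right_mono sum_nonneg c0) auto
  ultimately have main: "\<kappa> * (\<Sum>t<T. c t) \<le> V 0 + q * W" by linarith
  \<comment> \<open>The telescoped weights are shifted by one; the common factor
    \<open>inverse (1 - a)\<close> cancels after normalization, so both families define the same
    average.\<close>
  have "(\<Sum>t<T. w t / (\<Sum>s<T. w s) * Q t) = (\<Sum>t<T. w (Suc t) / W * Q t)"
    unfolding W_def w_Suc using a by (simp add: sum_distrib_left[symmetric])
  also have "\<dots> = (\<Sum>t<T. c t) / W" by (simp add: c_def sum_divide_distrib)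
  also have "\<dots> \<le> ((V 0 + q * W) / \<kappa>) / W"
    using main \<kappa>(2) W0 by (intro divide_right_mono) (simp_all add: field_simps)
  also have "\<dots> = (V 0 / W + q) / \<kappa>" using W0 by (simp add: field_simps)
  finally show ?thesis unfolding W_def .
qed

subsection \<open>Delayed SGD\<close>

lemma space_noise_past [simp]: "space (noise_past \<Omega> \<xi> t) = space \<Omega>"
  by (simp add: noise_past_def)

lemma noise_past_measurable:
  fixes \<xi> :: "nat \<Rightarrow> 'w \<Rightarrow> 'a::euclidean_space"
  assumes "s < t"
  shows "\<xi> s \<in> borel_measurable (noise_past \<Omega> \<xi> t)"
proof -
  have "(\<lambda>\<omega>. \<lambda>s\<in>{..<t}. \<xi> s \<omega>) \<in> measurable (noise_past \<Omega> \<xi> t) (\<Pi>\<^sub>M s\<in>{..<t}. (borel :: 'a measure))"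
    unfolding noise_past_def by (intro measurable_vimage_algebra1) (auto simp: space_PiM)
  then have "(\<lambda>\<omega>. (\<lambda>s\<in>{..<t}. \<xi> s \<omega>) s) \<in> borel_measurable (noise_past \<Omega> \<xi> t)"
    by (rule measurable_compose) (use assms in \<open>auto intro: measurable_component_singleton\<close>)
  then show ?thesis using assms by simp
qed

text \<open>Both \<open>L\<close> and \<open>\<gamma>\<close> are strictly positive here: for
  \<open>L = 0\<close> the cap is \<open>1 / 0 = 0\<close> in HOL, which would leave no stepsize.
  Runs with \<open>\<gamma> = 0\<close> are covered by
  \<open>delayed_sgd_stepsize_0\<close>.\<close>

locale delayed_run = smooth_function f gradf fstar L + prob_space \<Omega>
  for f :: "'a::euclidean_space \<Rightarrow> real" and gradf fstar L and \<Omega> :: "'w measure" +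
  fixes M \<sigma> \<gamma> :: real and \<tau> :: nat and x0 :: 'a and x \<xi> :: "nat \<Rightarrow> 'w \<Rightarrow> 'a"
  assumes run: "delayed_sgd \<Omega> gradf M \<sigma> \<tau> \<gamma> x0 x \<xi>"
    and L: "0 < L" and M: "0 \<le> M" and \<tau>: "1 \<le> \<tau>"
    and \<gamma>: "0 < \<gamma>" "\<gamma> \<le> 1 / (10 * L * (\<tau> + M))"
begin

definition g :: "nat \<Rightarrow> 'w \<Rightarrow> 'a" where "g s \<omega> = gradf (x s \<omega>) + \<xi> s \<omega>"

definition virtual :: "nat \<Rightarrow> 'w \<Rightarrow> 'a" where "virtual t \<omega> = x0 - \<gamma> *\<^sub>R (\<Sum>s<t. g s \<omega>)"

lemma \<gamma>_delay: "10 * L * \<gamma> * (\<tau> + M) \<le> 1"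
proof -
  have "0 < 10 * L * (\<tau> + M)" using L M \<tau> by simp
  from pos_le_divide_eq[OF this, THEN iffD1, OF \<gamma>(2)] show ?thesis by (simp add: ac_simps)
qed

lemma \<gamma>_step: "10 * L * \<gamma> * (1 + M) \<le> 1"
proof -
  have "10 * L * \<gamma> * (1 + M) \<le> 10 * L * \<gamma> * (\<tau> + M)"
    using \<gamma> L \<tau> by (intro mult_left_mono) auto
  then show ?thesis using \<gamma>_delay by simp
qed

lemma
  shows noise_integrable: "integrable \<Omega> (\<xi> t)"
    and noise_cond_indep: "cond_indep \<Omega> (vimage_algebra (space \<Omega>) (x t) borel)
      (vimage_algebra (space \<Omega>) (\<xi> t) borel) (noise_past \<Omega> \<xi> t)"
    and noise_cond_mean: "b \<in> Basis \<Longrightarrow>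
      AE \<omega> in \<Omega>. real_cond_exp \<Omega> (vimage_algebra (space \<Omega>) (x t) borel) (\<lambda>\<omega>'. \<xi> t \<omega>' \<bullet> b) \<omega> = 0"
    and noise_cond_variance:
      "AE \<omega> in \<Omega>. nn_cond_exp \<Omega> (vimage_algebra (space \<Omega>) (x t) borel)
          (\<lambda>\<omega>'. ennreal ((norm (\<xi> t \<omega>'))\<^sup>2)) \<omega>
        \<le> ennreal (M * (norm (gradf (x t \<omega>)))\<^sup>2 + \<sigma>\<^sup>2)"
  using run by (auto simp: delayed_sgd_def bounded_noise_def Let_def)

lemma noise_measurable [measurable]: "\<xi> t \<in> borel_measurable \<Omega>"
  using noise_integrable by auto

lemma subalgebra_noise_past: "subalgebra \<Omega> (noise_past \<Omega> \<xi> t)"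
  unfolding noise_past_def by (rule subalgebra_vimage_algebra) measurable

text \<open>Truncated subtraction encodes the waiting phase: for \<open>t \<le> \<tau>\<close> the
  sum is empty and gives \<open>x0\<close>.\<close>

lemma iterate_eq:
  assumes "\<omega> \<in> space \<Omega>"
  shows "x t \<omega> = x0 - \<gamma> *\<^sub>R (\<Sum>s<t-\<tau>. g s \<omega>)"
proof (induction t)
  case 0
  then show ?case using run assms by (auto simp: delayed_sgd_def)
next
  case (Suc t)
  show ?case
  proof (cases "\<tau> \<le> t")
    case True
    then have "x (Suc t) \<omega> = x t \<omega> - \<gamma> *\<^sub>R g (t - \<tau>) \<omega>"
      using run assms by (auto simp: delayed_sgd_def g_def)
    then show ?thesis using Suc True by (simp add: Suc_diff_le algebra_simps)
  next
    case False
    then show ?thesis using run assms by (auto simp: delayed_sgd_def)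
  qed
qed

lemma iterate_minus_virtual:
  assumes "\<omega> \<in> space \<Omega>"
  shows "x t \<omega> - virtual t \<omega> = \<gamma> *\<^sub>R (\<Sum>s\<in>{t-\<tau>..<t}. g s \<omega>)"
proof -
  have "(\<Sum>s<t. g s \<omega>) = (\<Sum>s<t-\<tau>. g s \<omega>) + (\<Sum>s\<in>{t-\<tau>..<t}. g s \<omega>)"
    by (metis atLeast0LessThan diff_le_self sum.atLeastLessThan_concat zero_le)
  then show ?thesis by (simp add: iterate_eq[OF assms] virtual_def algebra_simps)
qed

text \<open>The target \<open>N\<close> is left open since three instances are used:
  \<open>noise_past\<close>, the full space, and the sigma-algebra of the entire noise sequence,
  from which the output index is independent.\<close>

lemma iterate_measurable_wrt:
  assumes "space N = space \<Omega>" and "\<And>s. s < t \<Longrightarrow> \<xi> s \<in> borel_measurable N"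
  shows "x t \<in> borel_measurable N"
  using assms(2)
proof (induction t rule: less_induct)
  case (less t)
  have "(\<lambda>\<omega>. gradf (x s \<omega>) + \<xi> s \<omega>) \<in> borel_measurable N" if "s < t" for s
    using less.IH[OF that] less.prems that by (intro borel_measurable_add) auto
  then have "(\<lambda>\<omega>. x0 - \<gamma> *\<^sub>R (\<Sum>s<t-\<tau>. g s \<omega>)) \<in> borel_measurable N"
    unfolding g_def
    by (intro borel_measurable_diff borel_measurable_scaleR borel_measurable_sum) auto
  then show ?case
    using iterate_eq assms(1) by (subst measurable_cong[where g = "\<lambda>\<omega>. x0 - \<gamma> *\<^sub>R (\<Sum>s<t-\<tau>. g s \<omega>)"]) auto
qed

lemma iterate_measurable_past: "s \<le> t \<Longrightarrow> x s \<in> borel_measurable (noise_past \<Omega> \<xi> t)"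
  by (rule iterate_measurable_wrt) (auto intro: noise_past_measurable)

lemma virtual_measurable_past: "virtual t \<in> borel_measurable (noise_past \<Omega> \<xi> t)"
proof -
  have "(\<lambda>\<omega>. gradf (x s \<omega>) + \<xi> s \<omega>) \<in> borel_measurable (noise_past \<Omega> \<xi> t)" if "s < t" for s
    using iterate_measurable_past[of s t] noise_past_measurable[of s t] that
    by (intro borel_measurable_add) auto
  then show ?thesis
    unfolding virtual_def[abs_def] g_def
    by (intro borel_measurable_diff borel_measurable_scaleR borel_measurable_sum) auto
qed

lemma iterate_measurable [measurable]: "x t \<in> borel_measurable \<Omega>"
  by (rule iterate_measurable_wrt) auto

text \<open>\<open>h\<close> may depend on everything in the past, not only on \<open>x t\<close>;
  \<open>cond_indep_cond_exp_zero\<close> carries the zero conditional mean from \<open>x t\<close>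
  over to \<open>noise_past\<close>, one coordinate at a time. Square integrability makes the
  coordinate products integrable, so that \<open>h\<close> can be moved inside the conditional
  expectation.\<close>

lemma noise_orthogonal:
  assumes h: "h \<in> borel_measurable (noise_past \<Omega> \<xi> t)" "square_integrable h"
    and sq: "square_integrable (\<xi> t)"
  shows "(\<integral>\<omega>. h \<omega> \<bullet> \<xi> t \<omega> \<partial>\<Omega>) = 0"
proof -
  interpret H: finite_measure_subalgebra \<Omega> "noise_past \<Omega> \<xi> t"
    by unfold_locales (rule subalgebra_noise_past)
  have coord: "square_integrable (\<lambda>\<omega>. Y \<omega> \<bullet> b)"
    if "square_integrable Y" "b \<in> Basis" for Y :: "'w \<Rightarrow> 'a" and b
  proof (rule square_integrable_le[OF square_integrable_norm_sq[OF that(1)]])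
    show "(\<lambda>\<omega>. Y \<omega> \<bullet> b) \<in> borel_measurable \<Omega>"
      using square_integrable_measurable[OF that(1)] by simp
    show "(norm (Y \<omega> \<bullet> b))\<^sup>2 \<le> (norm (Y \<omega>))\<^sup>2" for \<omega>
      using power_mono[OF Basis_le_norm[OF that(2), of "Y \<omega>"], of 2] by simp
  qed
  have int: "integrable \<Omega> (\<lambda>\<omega>. (h \<omega> \<bullet> b) * (\<xi> t \<omega> \<bullet> b))" if "b \<in> Basis" for b
    using square_integrable_inner[OF coord[OF h(2) that] coord[OF sq that]] by simp
  have zero: "(\<integral>\<omega>. (h \<omega> \<bullet> b) * (\<xi> t \<omega> \<bullet> b) \<partial>\<Omega>) = 0" if b: "b \<in> Basis" for b
  proof -
    have "AE \<omega> in \<Omega>. real_cond_exp \<Omega> (noise_past \<Omega> \<xi> t) (\<lambda>\<omega>. \<xi> t \<omega> \<bullet> b) \<omega> = 0"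
    proof (rule cond_indep_cond_exp_zero[OF _ _ subalgebra_noise_past noise_cond_indep])
      show "(\<lambda>\<omega>. \<xi> t \<omega> \<bullet> b) \<in> borel_measurable (vimage_algebra (space \<Omega>) (\<xi> t) borel)"
        by (intro borel_measurable_inner measurable_vimage_algebra1) auto
    qed (auto intro: subalgebra_vimage_algebra noise_integrable noise_cond_mean[OF b])
    then have "AE \<omega> in \<Omega>. (h \<omega> \<bullet> b) * real_cond_exp \<Omega> (noise_past \<Omega> \<xi> t) (\<lambda>\<omega>. \<xi> t \<omega> \<bullet> b) \<omega> = 0"
      by eventually_elim simp
    then have "(\<integral>\<omega>. (h \<omega> \<bullet> b) * real_cond_exp \<Omega> (noise_past \<Omega> \<xi> t) (\<lambda>\<omega>. \<xi> t \<omega> \<bullet> b) \<omega> \<partial>\<Omega>) = 0"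
      by (rule integral_eq_zero_AE)
    moreover have "(\<integral>\<omega>. (h \<omega> \<bullet> b) * real_cond_exp \<Omega> (noise_past \<Omega> \<xi> t) (\<lambda>\<omega>. \<xi> t \<omega> \<bullet> b) \<omega> \<partial>\<Omega>)
        = (\<integral>\<omega>. (h \<omega> \<bullet> b) * (\<xi> t \<omega> \<bullet> b) \<partial>\<Omega>)"
      using h(1) by (intro H.real_cond_exp_intg(2) int b) auto
    ultimately show ?thesis by simp
  qed
  have "(\<integral>\<omega>. h \<omega> \<bullet> \<xi> t \<omega> \<partial>\<Omega>) = (\<integral>\<omega>. (\<Sum>b\<in>Basis. (h \<omega> \<bullet> b) * (\<xi> t \<omega> \<bullet> b)) \<partial>\<Omega>)"
    by (subst euclidean_inner) (rule refl)
  then show ?thesis by (simp add: Bochner_Integration.integral_sum[OF int] zero)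
qed

section \<open>Finite second moments along the run\<close>

lemma square_integrable_gradient:
  assumes "square_integrable Y"
  shows "square_integrable (\<lambda>\<omega>. gradf (Y \<omega>))"
proof (rule square_integrable_le)
  have "square_integrable (\<lambda>\<omega>. L *\<^sub>R Y \<omega>)" using assms by (rule square_integrable_scaleR)
  then show "integrable \<Omega> (\<lambda>\<omega>. 2 * (norm (L *\<^sub>R Y \<omega>))\<^sup>2 + 2 * (norm (gradf 0))\<^sup>2)"
    by (intro Bochner_Integration.integrable_add integrable_mult_right square_integrable_norm_sq)
      (simp_all add: square_integrable_const)
  show "(\<lambda>\<omega>. gradf (Y \<omega>)) \<in> borel_measurable \<Omega>"
    using square_integrable_measurable[OF assms] by simp
  fix \<omega>
  have "(norm (gradf (Y \<omega>) - gradf 0))\<^sup>2 \<le> (norm (L *\<^sub>R Y \<omega>))\<^sup>2"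
    using smooth[of "Y \<omega>" 0] L by (intro power_mono) auto
  moreover have "(norm (gradf (Y \<omega>)))\<^sup>2
      \<le> 2 * (norm (gradf (Y \<omega>) - gradf 0))\<^sup>2 + 2 * (norm (gradf 0))\<^sup>2"
    using norm_add_sq_le[of "gradf (Y \<omega>) - gradf 0" "gradf 0"] by simp
  ultimately show "(norm (gradf (Y \<omega>)))\<^sup>2 \<le> 2 * (norm (L *\<^sub>R Y \<omega>))\<^sup>2 + 2 * (norm (gradf 0))\<^sup>2"
    by linarith
qed

text \<open>\<open>f\<close> lies between \<open>fstar\<close> and the quadratic model at
  \<open>x0\<close> given by \<open>descent\<close>, and the latter is integrable along a square
  integrable \<open>Y\<close>.\<close>

lemma integrable_f:
  assumes "square_integrable Y"
  shows "integrable \<Omega> (\<lambda>\<omega>. f (Y \<omega>))"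
proof -
  have [measurable]: "Y \<in> borel_measurable \<Omega>" using assms by (rule square_integrable_measurable)
  have Y: "square_integrable (\<lambda>\<omega>. Y \<omega> - x0)" by (intro square_integrable_intros assms)
  define h where "h = (\<lambda>\<omega>. f x0 - fstar + gradf x0 \<bullet> (Y \<omega> - x0) + L / 2 * (norm (Y \<omega> - x0))\<^sup>2)"
  have "integrable \<Omega> h" unfolding h_def
    by (intro Bochner_Integration.integrable_add integrable_mult_right square_integrable_norm_sq[OF Y]
        square_integrable_inner[OF square_integrable_const Y]) auto
  then have "integrable \<Omega> (\<lambda>\<omega>. f (Y \<omega>) - fstar)"
  proof (rule Bochner_Integration.integrable_bound)
    show "AE \<omega> in \<Omega>. norm (f (Y \<omega>) - fstar) \<le> norm (h \<omega>)"
    proof (rule AE_I2)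
      fix \<omega>
      show "norm (f (Y \<omega>) - fstar) \<le> norm (h \<omega>)"
        using lower_bound[of "Y \<omega>"] descent[of "Y \<omega>" x0] by (simp add: h_def)
    qed
  qed measurable
  then have "integrable \<Omega> (\<lambda>\<omega>. (f (Y \<omega>) - fstar) + fstar)"
    by (intro Bochner_Integration.integrable_add) auto
  then show ?thesis by simp
qed

text \<open>Integrating the conditional bound in \<open>ennreal\<close>, where the tower property
  asks for no integrability, shows that the second moment is finite. Since only \<open>x t\<close>
  enters as a hypothesis, the strong induction in \<open>square_integrable_iterate\<close> can
  alternate between iterates and noise.\<close>

lemma noise_second_moment_aux:
  assumes "square_integrable (x t)"
  shows "square_integrable (\<xi> t)"
    and "(\<integral>\<omega>. (norm (\<xi> t \<omega>))\<^sup>2 \<partial>\<Omega>) \<le> M * (\<integral>\<omega>. (norm (gradf (x t \<omega>)))\<^sup>2 \<partial>\<Omega>) + \<sigma>\<^sup>2"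
proof -
  let ?G = "vimage_algebra (space \<Omega>) (x t) borel"
  interpret G: finite_measure_subalgebra \<Omega> ?G
    by unfold_locales (intro subalgebra_vimage_algebra iterate_measurable)
  define h where "h = (\<lambda>\<omega>. M * (norm (gradf (x t \<omega>)))\<^sup>2 + \<sigma>\<^sup>2)"
  have h0: "0 \<le> h \<omega>" for \<omega> using M by (simp add: h_def)
  have h: "integrable \<Omega> h"
    unfolding h_def using square_integrable_gradient[OF assms, THEN square_integrable_norm_sq] by simp
  have "(\<integral>\<^sup>+\<omega>. ennreal ((norm (\<xi> t \<omega>))\<^sup>2) \<partial>\<Omega>)
      = (\<integral>\<^sup>+\<omega>. nn_cond_exp \<Omega> ?G (\<lambda>\<omega>'. ennreal ((norm (\<xi> t \<omega>'))\<^sup>2)) \<omega> \<partial>\<Omega>)"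
    using G.nn_cond_exp_intg[of "\<lambda>_. 1" "\<lambda>\<omega>. ennreal ((norm (\<xi> t \<omega>))\<^sup>2)"] by simp
  also have "\<dots> \<le> (\<integral>\<^sup>+\<omega>. ennreal (h \<omega>) \<partial>\<Omega>)"
    unfolding h_def by (intro nn_integral_mono_AE noise_cond_variance)
  also have "\<dots> = ennreal (\<integral>\<omega>. h \<omega> \<partial>\<Omega>)"
    using h h0 by (intro nn_integral_eq_integral) auto
  finally have le: "(\<integral>\<^sup>+\<omega>. ennreal ((norm (\<xi> t \<omega>))\<^sup>2) \<partial>\<Omega>) \<le> ennreal (\<integral>\<omega>. h \<omega> \<partial>\<Omega>)" .
  then have int: "integrable \<Omega> (\<lambda>\<omega>. (norm (\<xi> t \<omega>))\<^sup>2)"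
    by (intro integrableI_bounded) (auto simp: le_less_trans)
  then show "square_integrable (\<xi> t)" by (simp add: square_integrable_def)
  have "(\<integral>\<omega>. (norm (\<xi> t \<omega>))\<^sup>2 \<partial>\<Omega>) \<le> (\<integral>\<omega>. h \<omega> \<partial>\<Omega>)"
    using le h0 by (subst (asm) nn_integral_eq_integral[OF int]) (auto simp: ennreal_le_iff)
  also have "\<dots> = M * (\<integral>\<omega>. (norm (gradf (x t \<omega>)))\<^sup>2 \<partial>\<Omega>) + \<sigma>\<^sup>2"
    unfolding h_def using square_integrable_gradient[OF assms, THEN square_integrable_norm_sq]
    by (simp add: prob_space)
  finally show "(\<integral>\<omega>. (norm (\<xi> t \<omega>))\<^sup>2 \<partial>\<Omega>) \<le> M * (\<integral>\<omega>. (norm (gradf (x t \<omega>)))\<^sup>2 \<partial>\<Omega>) + \<sigma>\<^sup>2" .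
qed

lemma square_integrable_iterate: "square_integrable (x t)"
proof (induction t rule: less_induct)
  case (less t)
  have "square_integrable (\<lambda>\<omega>. x0 - \<gamma> *\<^sub>R (\<Sum>s<t-\<tau>. gradf (x s \<omega>) + \<xi> s \<omega>))"
    by (intro square_integrable_intros square_integrable_gradient noise_second_moment_aux less) auto
  then have "integrable \<Omega> (\<lambda>\<omega>. (norm (x0 - \<gamma> *\<^sub>R (\<Sum>s<t-\<tau>. g s \<omega>)))\<^sup>2)"
    unfolding g_def by (rule square_integrable_norm_sq)
  then have "integrable \<Omega> (\<lambda>\<omega>. (norm (x t \<omega>))\<^sup>2)"
    by (rule Bochner_Integration.integrable_cong[THEN iffD2, rotated -1]) (auto simp: iterate_eq)
  then show ?case by (simp add: square_integrable_def)
qed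

lemmas square_integrable_noise = noise_second_moment_aux(1)[OF square_integrable_iterate]
lemmas noise_second_moment = noise_second_moment_aux(2)[OF square_integrable_iterate]
lemmas square_integrable_iterate_gradient = square_integrable_gradient[OF square_integrable_iterate]

lemma square_integrable_virtual: "square_integrable (virtual t)"
  unfolding virtual_def[abs_def] g_def
  by (intro square_integrable_intros square_integrable_iterate_gradient square_integrable_noise)

text \<open>Pythagoras in \<open>L^2\<close>. It is used with \<open>c = \<gamma>\<close> for a
  virtual step and with \<open>c = -1\<close> to append one more noise term.\<close>

lemma second_moment_minus_noise:
  assumes h: "h \<in> borel_measurable (noise_past \<Omega> \<xi> t)" "square_integrable h"
  shows "(\<integral>\<omega>. (norm (h \<omega> - c *\<^sub>R \<xi> t \<omega>))\<^sup>2 \<partial>\<Omega>)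
    = (\<integral>\<omega>. (norm (h \<omega>))\<^sup>2 \<partial>\<Omega>) + c\<^sup>2 * (\<integral>\<omega>. (norm (\<xi> t \<omega>))\<^sup>2 \<partial>\<Omega>)"
proof -
  have "(norm (h \<omega> - c *\<^sub>R \<xi> t \<omega>))\<^sup>2
      = (norm (h \<omega>))\<^sup>2 - 2 * c * (h \<omega> \<bullet> \<xi> t \<omega>) + c\<^sup>2 * (norm (\<xi> t \<omega>))\<^sup>2" for \<omega>
    unfolding power2_norm_eq_inner by (simp add: algebra_simps inner_commute power2_eq_square)
  then show ?thesis
    using square_integrable_norm_sq[OF h(2)] square_integrable_norm_sq[OF square_integrable_noise[of t]]
      square_integrable_inner[OF h(2) square_integrable_noise[of t]]
      noise_orthogonal[OF h square_integrable_noise]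
    by simp
qed

lemma second_moment_noise_sum:
  "(\<integral>\<omega>. (norm (\<Sum>s\<in>{m..<n}. \<xi> s \<omega>))\<^sup>2 \<partial>\<Omega>) = (\<Sum>s\<in>{m..<n}. \<integral>\<omega>. (norm (\<xi> s \<omega>))\<^sup>2 \<partial>\<Omega>)"
proof (induction n)
  case (Suc n)
  show ?case
  proof (cases "m \<le> n")
    case True
    have "(\<lambda>\<omega>. \<Sum>s\<in>{m..<n}. \<xi> s \<omega>) \<in> borel_measurable (noise_past \<Omega> \<xi> n)"
      by (intro borel_measurable_sum noise_past_measurable) auto
    moreover have "square_integrable (\<lambda>\<omega>. \<Sum>s\<in>{m..<n}. \<xi> s \<omega>)"
      by (intro square_integrable_sum square_integrable_noise)
    ultimately show ?thesis
      using second_moment_minus_noise[of "\<lambda>\<omega>. \<Sum>s\<in>{m..<n}. \<xi> s \<omega>" n "-1"] Suc True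
      by simp
  qed simp
qed simp

section \<open>Drift and one-step recursions in expectation\<close>

lemma virtual_Suc: "virtual (Suc t) \<omega> = virtual t \<omega> - \<gamma> *\<^sub>R g t \<omega>"
  by (simp add: virtual_def algebra_simps)

text \<open>Only the gradients pay the factor \<open>\<tau>\<close> of Cauchy-Schwarz; the
  orthogonal noise terms pay \<open>M\<close> each. This is why the sum \<open>\<tau> + M\<close>
  appears instead of a product. The factor 2 comes from separating gradients and noise.\<close>

lemma drift_bound:
  "(\<integral>\<omega>. (norm (x t \<omega> - virtual t \<omega>))\<^sup>2 \<partial>\<Omega>)
    \<le> 2 * \<gamma>\<^sup>2 * (\<tau> + M) * (\<Sum>s\<in>{t-\<tau>..<t}. \<integral>\<omega>. (norm (gradf (x s \<omega>)))\<^sup>2 \<partial>\<Omega>) + 2 * \<gamma>\<^sup>2 * \<tau> * \<sigma>\<^sup>2"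
proof -
  let ?S = "{t-\<tau>..<t}"
  have card: "real (card ?S) \<le> \<tau>" by simp
  define G where "G = (\<lambda>s. \<integral>\<omega>. (norm (gradf (x s \<omega>)))\<^sup>2 \<partial>\<Omega>)"
  note int = square_integrable_norm_sq[OF square_integrable_iterate_gradient]
    square_integrable_norm_sq[OF square_integrable_sum[OF square_integrable_noise]]
  have "(\<integral>\<omega>. (norm (x t \<omega> - virtual t \<omega>))\<^sup>2 \<partial>\<Omega>)
      \<le> (\<integral>\<omega>. 2 * \<gamma>\<^sup>2 * (\<tau> * (\<Sum>s\<in>?S. (norm (gradf (x s \<omega>)))\<^sup>2)) + 2 * \<gamma>\<^sup>2 * (norm (\<Sum>s\<in>?S. \<xi> s \<omega>))\<^sup>2 \<partial>\<Omega>)"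
  proof (rule integral_mono)
    show "integrable \<Omega> (\<lambda>\<omega>. (norm (x t \<omega> - virtual t \<omega>))\<^sup>2)"
      by (intro square_integrable_norm_sq square_integrable_diff square_integrable_iterate square_integrable_virtual)
    show "integrable \<Omega> (\<lambda>\<omega>. 2 * \<gamma>\<^sup>2 * (\<tau> * (\<Sum>s\<in>?S. (norm (gradf (x s \<omega>)))\<^sup>2)) + 2 * \<gamma>\<^sup>2 * (norm (\<Sum>s\<in>?S. \<xi> s \<omega>))\<^sup>2)"
      by (intro Bochner_Integration.integrable_add integrable_mult_right Bochner_Integration.integrable_sum int)
    fix \<omega> assume \<omega>: "\<omega> \<in> space \<Omega>"
    have "(norm (\<Sum>s\<in>?S. gradf (x s \<omega>)))\<^sup>2 \<le> \<tau> * (\<Sum>s\<in>?S. (norm (gradf (x s \<omega>)))\<^sup>2)"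
      using norm_sum_sq_le[of "\<lambda>s. gradf (x s \<omega>)" ?S] mult_right_mono[OF card, of "\<Sum>s\<in>?S. (norm (gradf (x s \<omega>)))\<^sup>2"]
      by (simp add: sum_nonneg)
    moreover have "(norm (\<Sum>s\<in>?S. g s \<omega>))\<^sup>2
        \<le> 2 * (norm (\<Sum>s\<in>?S. gradf (x s \<omega>)))\<^sup>2 + 2 * (norm (\<Sum>s\<in>?S. \<xi> s \<omega>))\<^sup>2"
      unfolding g_def sum.distrib by (rule norm_add_sq_le)
    ultimately have "(norm (\<Sum>s\<in>?S. g s \<omega>))\<^sup>2
        \<le> 2 * (\<tau> * (\<Sum>s\<in>?S. (norm (gradf (x s \<omega>)))\<^sup>2)) + 2 * (norm (\<Sum>s\<in>?S. \<xi> s \<omega>))\<^sup>2"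
      by linarith
    from mult_left_mono[OF this, of "\<gamma>\<^sup>2"]
    show "(norm (x t \<omega> - virtual t \<omega>))\<^sup>2
      \<le> 2 * \<gamma>\<^sup>2 * (\<tau> * (\<Sum>s\<in>?S. (norm (gradf (x s \<omega>)))\<^sup>2)) + 2 * \<gamma>\<^sup>2 * (norm (\<Sum>s\<in>?S. \<xi> s \<omega>))\<^sup>2"
      unfolding iterate_minus_virtual[OF \<omega>] by (simp add: power_mult_distrib algebra_simps)
  qed
  also have "\<dots> = 2 * \<gamma>\<^sup>2 * (\<tau> * (\<Sum>s\<in>?S. G s)) + 2 * \<gamma>\<^sup>2 * (\<Sum>s\<in>?S. \<integral>\<omega>. (norm (\<xi> s \<omega>))\<^sup>2 \<partial>\<Omega>)"
    unfolding G_def second_moment_noise_sum[symmetric]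
    by (subst Bochner_Integration.integral_add)
      (auto intro!: integrable_mult_right Bochner_Integration.integrable_sum int
        simp: Bochner_Integration.integral_sum int)
  finally have E: "(\<integral>\<omega>. (norm (x t \<omega> - virtual t \<omega>))\<^sup>2 \<partial>\<Omega>)
      \<le> 2 * \<gamma>\<^sup>2 * (\<tau> * (\<Sum>s\<in>?S. G s)) + 2 * \<gamma>\<^sup>2 * (\<Sum>s\<in>?S. \<integral>\<omega>. (norm (\<xi> s \<omega>))\<^sup>2 \<partial>\<Omega>)" .
  have "(\<Sum>s\<in>?S. \<integral>\<omega>. (norm (\<xi> s \<omega>))\<^sup>2 \<partial>\<Omega>) \<le> (\<Sum>s\<in>?S. M * G s + \<sigma>\<^sup>2)"
    unfolding G_def by (intro sum_mono noise_second_moment)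
  also have "\<dots> = M * (\<Sum>s\<in>?S. G s) + card ?S * \<sigma>\<^sup>2"
    by (simp add: sum.distrib sum_distrib_left)
  also have "\<dots> \<le> M * (\<Sum>s\<in>?S. G s) + \<tau> * \<sigma>\<^sup>2"
    using card by (intro add_left_mono mult_right_mono) auto
  finally have "2 * \<gamma>\<^sup>2 * (\<Sum>s\<in>?S. \<integral>\<omega>. (norm (\<xi> s \<omega>))\<^sup>2 \<partial>\<Omega>)
      \<le> 2 * \<gamma>\<^sup>2 * (M * (\<Sum>s\<in>?S. G s) + \<tau> * \<sigma>\<^sup>2)" by (rule mult_left_mono) simp
  with E show ?thesis unfolding G_def by (simp add: algebra_simps)
qed

lemma gradient_second_moment_le:
  "(\<integral>\<omega>. (norm (gradf (x t \<omega>)))\<^sup>2 \<partial>\<Omega>) \<le> 2 * L * (\<integral>\<omega>. f (x t \<omega>) - fstar \<partial>\<Omega>)"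
proof -
  have "(\<integral>\<omega>. (norm (gradf (x t \<omega>)))\<^sup>2 \<partial>\<Omega>) \<le> (\<integral>\<omega>. 2 * L * (f (x t \<omega>) - fstar) \<partial>\<Omega>)"
    using norm_gradient_sq_le[of L] L
    by (intro integral_mono square_integrable_norm_sq[OF square_integrable_iterate_gradient]
        integrable_mult_right Bochner_Integration.integrable_diff integrable_f square_integrable_iterate) auto
  then show ?thesis by simp
qed

lemma gap_nonneg: "0 \<le> (\<integral>\<omega>. f (x t \<omega>) - fstar \<partial>\<Omega>)"
  using lower_bound by (intro integral_nonneg_AE AE_I2) simp

text \<open>The constant 12 is the product of the 3 from \<open>quasi_convex_step\<close>, the 2
  from \<open>drift_bound\<close> and the 2 from trading squared gradients for gaps.\<close>

lemma quasi_convex_recursion: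
  assumes qc: "quasi_convex f gradf fstar \<mu> xstar" and \<mu>: "0 \<le> \<mu>"
  defines "R \<equiv> \<lambda>t. \<integral>\<omega>. (norm (virtual t \<omega> - xstar))\<^sup>2 \<partial>\<Omega>"
    and "F \<equiv> \<lambda>t. \<integral>\<omega>. f (x t \<omega>) - fstar \<partial>\<Omega>"
  shows "R (Suc t) \<le> (1 - \<mu> * \<gamma> / 2) * R t - 4 / 5 * \<gamma> * F t + 8 / 5 * \<gamma>\<^sup>2 * \<sigma>\<^sup>2
    + 12 * L\<^sup>2 * \<gamma>^3 * (\<tau> + M) * (\<Sum>s\<in>{t-\<tau>..<t}. F s)"
proof -
  define h where "h = (\<lambda>\<omega>. virtual t \<omega> - xstar - \<gamma> *\<^sub>R gradf (x t \<omega>))"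
  have "(\<lambda>\<omega>. gradf (x t \<omega>)) \<in> borel_measurable (noise_past \<Omega> \<xi> t)"
    by (rule measurable_compose[OF iterate_measurable_past gradient_borel_measurable]) simp
  then have h: "h \<in> borel_measurable (noise_past \<Omega> \<xi> t)" "square_integrable h"
    unfolding h_def using virtual_measurable_past[of t]
    by (simp_all add: square_integrable_intros square_integrable_virtual square_integrable_iterate_gradient)
  note int = square_integrable_norm_sq[OF square_integrable_iterate_gradient[of t]]
    square_integrable_norm_sq[OF h(2)] integrable_f[OF square_integrable_iterate[of t]]
    square_integrable_norm_sq[OF square_integrable_diff[OF square_integrable_virtual[of t] square_integrable_const[of xstar]]]
    square_integrable_norm_sq[OF square_integrable_diff[OF square_integrable_iterate[of t] square_integrable_virtual[of t]]]
  define E where "E = (\<integral>\<omega>. (norm (x t \<omega> - virtual t \<omega>))\<^sup>2 \<partial>\<Omega>)"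
  have "R (Suc t) = (\<integral>\<omega>. (norm (h \<omega> - \<gamma> *\<^sub>R \<xi> t \<omega>))\<^sup>2 \<partial>\<Omega>)"
    unfolding R_def h_def by (simp add: virtual_Suc g_def algebra_simps)
  also have "\<dots> = (\<integral>\<omega>. (norm (h \<omega>))\<^sup>2 \<partial>\<Omega>) + \<gamma>\<^sup>2 * (\<integral>\<omega>. (norm (\<xi> t \<omega>))\<^sup>2 \<partial>\<Omega>)"
    by (rule second_moment_minus_noise[OF h])
  also have "\<dots> \<le> (\<integral>\<omega>. (norm (h \<omega>))\<^sup>2 \<partial>\<Omega>) + \<gamma>\<^sup>2 * (M * (\<integral>\<omega>. (norm (gradf (x t \<omega>)))\<^sup>2 \<partial>\<Omega>) + \<sigma>\<^sup>2)"
    by (intro add_left_mono mult_left_mono noise_second_moment) auto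
  also have "\<dots> = (\<integral>\<omega>. (norm (h \<omega>))\<^sup>2 + \<gamma>\<^sup>2 * M * (norm (gradf (x t \<omega>)))\<^sup>2 \<partial>\<Omega>) + \<gamma>\<^sup>2 * \<sigma>\<^sup>2"
    using int by (simp add: algebra_simps)
  also have "(\<integral>\<omega>. (norm (h \<omega>))\<^sup>2 + \<gamma>\<^sup>2 * M * (norm (gradf (x t \<omega>)))\<^sup>2 \<partial>\<Omega>)
      \<le> (\<integral>\<omega>. (1 - \<mu> * \<gamma> / 2) * (norm (virtual t \<omega> - xstar))\<^sup>2 - 4 / 5 * \<gamma> * (f (x t \<omega>) - fstar)
          + 3 * L * \<gamma> * (norm (x t \<omega> - virtual t \<omega>))\<^sup>2 \<partial>\<Omega>)"
  proof (rule integral_mono)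
    show "(norm (h \<omega>))\<^sup>2 + \<gamma>\<^sup>2 * M * (norm (gradf (x t \<omega>)))\<^sup>2
      \<le> (1 - \<mu> * \<gamma> / 2) * (norm (virtual t \<omega> - xstar))\<^sup>2 - 4 / 5 * \<gamma> * (f (x t \<omega>) - fstar)
        + 3 * L * \<gamma> * (norm (x t \<omega> - virtual t \<omega>))\<^sup>2" for \<omega>
      unfolding h_def using \<gamma> by (intro quasi_convex_step qc L \<mu> \<gamma>_step M) auto
  qed (use int in auto)
  also have "\<dots> = (1 - \<mu> * \<gamma> / 2) * R t - 4 / 5 * \<gamma> * F t + 3 * L * \<gamma> * E"
    using int unfolding R_def F_def E_def by (simp add: prob_space)
  also have "E \<le> 2 * \<gamma>\<^sup>2 * (\<tau> + M) * (\<Sum>s\<in>{t-\<tau>..<t}. \<integral>\<omega>. (norm (gradf (x s \<omega>)))\<^sup>2 \<partial>\<Omega>) + 2 * \<gamma>\<^sup>2 * \<tau> * \<sigma>\<^sup>2"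
    unfolding E_def by (rule drift_bound)
  also have "(\<Sum>s\<in>{t-\<tau>..<t}. \<integral>\<omega>. (norm (gradf (x s \<omega>)))\<^sup>2 \<partial>\<Omega>) \<le> (\<Sum>s\<in>{t-\<tau>..<t}. 2 * L * F s)"
    unfolding F_def by (intro sum_mono gradient_second_moment_le)
  also have "\<dots> = 2 * L * (\<Sum>s\<in>{t-\<tau>..<t}. F s)" by (simp only: sum_distrib_left)
  finally have "R (Suc t) \<le> (1 - \<mu> * \<gamma> / 2) * R t - 4 / 5 * \<gamma> * F t
      + 3 * L * \<gamma> * (2 * \<gamma>\<^sup>2 * (\<tau> + M) * (2 * L * (\<Sum>s\<in>{t-\<tau>..<t}. F s)) + 2 * \<gamma>\<^sup>2 * \<tau> * \<sigma>\<^sup>2) + \<gamma>\<^sup>2 * \<sigma>\<^sup>2"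
    using L \<gamma> M \<tau> by (simp add: mult_left_mono)
  \<comment> \<open>The drift adds \<open>6 * L * \<gamma> * \<tau>\<close>, hence at most
    \<open>3 / 5\<close>, to the coefficient 1 of
    \<open>\<gamma>\<^sup>2 * \<sigma>\<^sup>2\<close>; the total is \<open>8 / 5\<close>.\<close>
  moreover have "10 * L * \<gamma> * \<tau> * (\<gamma>\<^sup>2 * \<sigma>\<^sup>2) \<le> 1 * (\<gamma>\<^sup>2 * \<sigma>\<^sup>2)"
  proof (rule mult_right_mono)
    have "10 * L * \<gamma> * \<tau> \<le> 10 * L * \<gamma> * (\<tau> + M)" using L \<gamma> M by simp
    then show "10 * L * \<gamma> * \<tau> \<le> 1" using \<gamma>_delay by simp
  qed simp
  ultimately show ?thesis
    by (simp add: algebra_simps power2_eq_square power3_eq_cube)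
qed

text \<open>\<open>descent\<close> is applied between consecutive virtual iterates, since these move
  by the current gradient \<open>g t\<close>. There is no contraction, so this feeds
  \<open>delayed_recursion\<close> with \<open>a = 0\<close>.\<close>

lemma nonconvex_recursion:
  defines "V \<equiv> \<lambda>t. \<integral>\<omega>. f (virtual t \<omega>) - fstar \<partial>\<Omega>"
    and "G \<equiv> \<lambda>t. \<integral>\<omega>. (norm (gradf (x t \<omega>)))\<^sup>2 \<partial>\<Omega>"
  shows "V (Suc t) \<le> V t - 9 / 20 * \<gamma> * G t + 3 / 5 * L * \<gamma>\<^sup>2 * \<sigma>\<^sup>2
    + L\<^sup>2 * \<gamma>^3 * (\<tau> + M) * (\<Sum>s\<in>{t-\<tau>..<t}. G s)"
proof -
  note sq = square_integrable_iterate_gradient[of t] square_integrable_virtual[of t]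
    square_integrable_gradient[OF square_integrable_virtual[of t]] square_integrable_noise[of t]
  have sqg: "square_integrable (g t)"
    unfolding g_def[abs_def] by (intro square_integrable_intros sq)
  note int = square_integrable_norm_sq[OF sq(1)] square_integrable_norm_sq[OF sqg]
    integrable_f[OF sq(2)] integrable_f[OF square_integrable_virtual[of "Suc t"]]
    square_integrable_inner[OF sq(3,1)] square_integrable_inner[OF sq(3) sqg]
    square_integrable_inner[OF sq(3,4)]
    square_integrable_norm_sq[OF square_integrable_diff[OF square_integrable_iterate[of t] sq(2)]]
  define E where "E = (\<integral>\<omega>. (norm (x t \<omega> - virtual t \<omega>))\<^sup>2 \<partial>\<Omega>)"
  have g_sq: "(\<integral>\<omega>. (norm (g t \<omega>))\<^sup>2 \<partial>\<Omega>) \<le> (1 + M) * G t + \<sigma>\<^sup>2"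
  proof -
    have "(\<lambda>\<omega>. gradf (x t \<omega>)) \<in> borel_measurable (noise_past \<Omega> \<xi> t)"
      by (rule measurable_compose[OF iterate_measurable_past gradient_borel_measurable]) simp
    from second_moment_minus_noise[OF this sq(1), of "-1"] noise_second_moment[of t]
    show ?thesis by (simp add: g_def G_def algebra_simps)
  qed
  \<comment> \<open>The virtual iterate is in general not a function of \<open>x t\<close>;
    orthogonality to the whole past is essential at this point.\<close>
  have orth: "(\<integral>\<omega>. gradf (virtual t \<omega>) \<bullet> \<xi> t \<omega> \<partial>\<Omega>) = 0"
    by (intro noise_orthogonal sq measurable_compose[OF virtual_measurable_past gradient_borel_measurable])
  have cross: "(\<integral>\<omega>. gradf (virtual t \<omega>) \<bullet> g t \<omega> \<partial>\<Omega>) = (\<integral>\<omega>. gradf (virtual t \<omega>) \<bullet> gradf (x t \<omega>) \<partial>\<Omega>)"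
    using orth int by (simp add: g_def inner_add_right)
  have "V (Suc t) \<le> (\<integral>\<omega>. (f (virtual t \<omega>) - fstar) - \<gamma> * (gradf (virtual t \<omega>) \<bullet> g t \<omega>)
      + L / 2 * \<gamma>\<^sup>2 * (norm (g t \<omega>))\<^sup>2 \<partial>\<Omega>)"
    unfolding V_def
  proof (rule integral_mono)
    show "f (virtual (Suc t) \<omega>) - fstar \<le> (f (virtual t \<omega>) - fstar)
        - \<gamma> * (gradf (virtual t \<omega>) \<bullet> g t \<omega>) + L / 2 * \<gamma>\<^sup>2 * (norm (g t \<omega>))\<^sup>2" for \<omega>
      using descent[of "virtual (Suc t) \<omega>" "virtual t \<omega>"] by (simp add: virtual_Suc power_mult_distrib)
  qed (use int in auto)
  also have "\<dots> = (\<integral>\<omega>. f (virtual t \<omega>) - fstar \<partial>\<Omega>) - \<gamma> * (\<integral>\<omega>. gradf (virtual t \<omega>) \<bullet> gradf (x t \<omega>) \<partial>\<Omega>)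
      + L / 2 * \<gamma>\<^sup>2 * (\<integral>\<omega>. (norm (g t \<omega>))\<^sup>2 \<partial>\<Omega>)"
    using int cross by simp
  also have "\<dots> \<le> (\<integral>\<omega>. f (virtual t \<omega>) - fstar \<partial>\<Omega>) - \<gamma> * (\<integral>\<omega>. gradf (virtual t \<omega>) \<bullet> gradf (x t \<omega>) \<partial>\<Omega>)
      + L / 2 * \<gamma>\<^sup>2 * ((1 + M) * G t + \<sigma>\<^sup>2)"
    using L by (intro add_left_mono mult_left_mono g_sq) auto
  also have "\<dots> = (\<integral>\<omega>. f (virtual t \<omega>) - \<gamma> * (gradf (virtual t \<omega>) \<bullet> gradf (x t \<omega>))
      + L / 2 * \<gamma>\<^sup>2 * (1 + M) * (norm (gradf (x t \<omega>)))\<^sup>2 \<partial>\<Omega>) - fstar + L / 2 * \<gamma>\<^sup>2 * \<sigma>\<^sup>2"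
    using int by (simp add: G_def prob_space algebra_simps)
  also have "(\<integral>\<omega>. f (virtual t \<omega>) - \<gamma> * (gradf (virtual t \<omega>) \<bullet> gradf (x t \<omega>))
      + L / 2 * \<gamma>\<^sup>2 * (1 + M) * (norm (gradf (x t \<omega>)))\<^sup>2 \<partial>\<Omega>)
    \<le> (\<integral>\<omega>. f (virtual t \<omega>) - 9 / 20 * \<gamma> * (norm (gradf (x t \<omega>)))\<^sup>2
      + L\<^sup>2 / 2 * \<gamma> * (norm (x t \<omega> - virtual t \<omega>))\<^sup>2 \<partial>\<Omega>)"
  proof (rule integral_mono)
    show "f (virtual t \<omega>) - \<gamma> * (gradf (virtual t \<omega>) \<bullet> gradf (x t \<omega>))
      + L / 2 * \<gamma>\<^sup>2 * (1 + M) * (norm (gradf (x t \<omega>)))\<^sup>2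
      \<le> f (virtual t \<omega>) - 9 / 20 * \<gamma> * (norm (gradf (x t \<omega>)))\<^sup>2
      + L\<^sup>2 / 2 * \<gamma> * (norm (x t \<omega> - virtual t \<omega>))\<^sup>2" for \<omega>
      using \<gamma> by (intro nonconvex_step L \<gamma>_step) auto
  qed (use int in auto)
  also have "\<dots> = V t + fstar - 9 / 20 * \<gamma> * G t + L\<^sup>2 / 2 * \<gamma> * E"
    using int unfolding V_def G_def E_def by (simp add: prob_space)
  also have "E \<le> 2 * \<gamma>\<^sup>2 * (\<tau> + M) * (\<Sum>s\<in>{t-\<tau>..<t}. G s) + 2 * \<gamma>\<^sup>2 * \<tau> * \<sigma>\<^sup>2"
    unfolding E_def G_def by (rule drift_bound)
  finally have "V (Suc t) \<le> V t + fstar - 9 / 20 * \<gamma> * G t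
      + L\<^sup>2 / 2 * \<gamma> * (2 * \<gamma>\<^sup>2 * (\<tau> + M) * (\<Sum>s\<in>{t-\<tau>..<t}. G s) + 2 * \<gamma>\<^sup>2 * \<tau> * \<sigma>\<^sup>2) - fstar + L / 2 * \<gamma>\<^sup>2 * \<sigma>\<^sup>2"
    using L \<gamma> M \<tau> by (simp add: mult_left_mono)
  \<comment> \<open>The noise coefficient is \<open>1 / 2\<close> from the second-order term plus
    \<open>L * \<gamma> * \<tau> \<le> 1 / 10\<close> from the drift, that is
    \<open>3 / 5\<close>.\<close>
  moreover have "10 * L * \<gamma> * \<tau> * (L * \<gamma>\<^sup>2 * \<sigma>\<^sup>2) \<le> 1 * (L * \<gamma>\<^sup>2 * \<sigma>\<^sup>2)"
  proof (rule mult_right_mono)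
    have "10 * L * \<gamma> * \<tau> \<le> 10 * L * \<gamma> * (\<tau> + M)" using L \<gamma> M by simp
    then show "10 * L * \<gamma> * \<tau> \<le> 1" using \<gamma>_delay by simp
  qed (use L in simp)
  ultimately show ?thesis
    by (simp add: algebra_simps power2_eq_square power3_eq_cube)
qed

end

text \<open>Bernoulli's inequality keeps the power of \<open>1 - a\<close> above
  \<open>19 / 20\<close>, and \<open>10 / 9\<close> is a convenient weaker bound. It controls the
  growth of the weights over one delay.\<close>

lemma bernoulli_inverse_power_le:
  fixes a :: real
  assumes "0 \<le> a" "\<tau> * a \<le> 1 / 20" "1 \<le> \<tau>"
  shows "inverse (1 - a) ^ \<tau> \<le> 10 / 9"
proof -
  have "a \<le> \<tau> * a" using assms mult_right_mono[of 1 "real \<tau>" a] by simp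
  then have "1 - \<tau> * a \<le> (1 - a) ^ \<tau>"
    using Bernoulli_inequality[of "- a" \<tau>] assms by simp
  then have "9 / 10 \<le> (1 - a) ^ \<tau>" using assms by linarith
  then have "inverse ((1 - a) ^ \<tau>) \<le> inverse (9 / 10)" by (intro le_imp_inverse_le) auto
  then show ?thesis by (simp add: power_inverse)
qed

section \<open>Averaged rates and the random output point\<close>

context delayed_run
begin

lemma quasi_convex_rate:
  assumes qc: "quasi_convex f gradf fstar \<mu> xstar" and \<mu>: "0 \<le> \<mu>" and T: "1 \<le> T"
  defines "w \<equiv> \<lambda>t. inverse (1 - \<mu> * \<gamma> / 2) ^ t"
  shows "(\<Sum>t<T. w t / (\<Sum>s<T. w s) * (\<integral>\<omega>. f (x t \<omega>) - fstar \<partial>\<Omega>))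
    \<le> ((norm (x0 - xstar))\<^sup>2 / (\<Sum>t<T. w (Suc t)) + 8 / 5 * \<gamma>\<^sup>2 * \<sigma>\<^sup>2) / (33 / 50 * \<gamma>)"
    and "\<mu> * \<gamma> / 2 < 1"
proof -
  define u where "u = L * \<gamma> * \<tau>"
  define v where "v = L * \<gamma> * (\<tau> + M)"
  have u0: "0 \<le> u" using L \<gamma> by (simp add: u_def)
  have "u \<le> v" unfolding u_def v_def using L \<gamma> M by (intro mult_left_mono) auto
  moreover have v: "v \<le> 1 / 10" using \<gamma>_delay by (simp add: v_def)
  ultimately have u: "u \<le> 1 / 10" by simp
  have "\<mu> * (\<gamma> * \<tau>) \<le> L * (\<gamma> * \<tau>)"
    using quasi_convex_const_le[OF qc L] \<gamma> by (intro mult_right_mono) auto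
  then have a: "\<tau> * (\<mu> * \<gamma> / 2) \<le> 1 / 20" using u by (simp add: u_def algebra_simps)
  moreover have "1 * (\<mu> * \<gamma> / 2) \<le> \<tau> * (\<mu> * \<gamma> / 2)"
    using \<tau> \<mu> \<gamma> by (intro mult_right_mono) auto
  ultimately show a1: "\<mu> * \<gamma> / 2 < 1" by linarith
  have w: "w \<tau> \<le> 10 / 9"
    unfolding w_def using a \<tau> \<mu> \<gamma> by (intro bernoulli_inverse_power_le) auto
  have "u * v \<le> 1 / 10 * (1 / 10)" using u v u0 \<open>u \<le> v\<close> by (intro mult_mono) auto
  have "12 * L\<^sup>2 * \<gamma>^3 * (\<tau> + M) * \<tau> * w \<tau> = \<gamma> * (12 * (u * v) * w \<tau>)"
    by (simp add: u_def v_def power2_eq_square power3_eq_cube)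
  also have "12 * (u * v) * w \<tau> \<le> 12 * (1 / 100) * (10 / 9)"
    using \<open>u * v \<le> _\<close> \<open>u \<le> v\<close> u0 w a1 by (intro mult_mono) (auto simp: w_def)
  finally have "12 * L\<^sup>2 * \<gamma>^3 * (\<tau> + M) * \<tau> * w \<tau> \<le> \<gamma> * (12 * (1 / 100) * (10 / 9))"
    using \<gamma>(1) by simp
  \<comment> \<open>The delay costs \<open>12 / 100 * 10 / 9 = 2 / 15\<close>, and
    \<open>4 / 5 - 2 / 15 = 2 / 3\<close>; \<open>33 / 50\<close> lies just below.\<close>
  then have "33 / 50 * \<gamma> + 12 * L\<^sup>2 * \<gamma>^3 * (\<tau> + M) * \<tau> * w \<tau> \<le> 4 / 5 * \<gamma>"
    using \<gamma>(1) by linarith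
  then have "(\<Sum>t<T. w t / (\<Sum>s<T. w s) * (\<integral>\<omega>. f (x t \<omega>) - fstar \<partial>\<Omega>))
    \<le> ((\<integral>\<omega>. (norm (virtual 0 \<omega> - xstar))\<^sup>2 \<partial>\<Omega>) / (\<Sum>t<T. w (Suc t)) + 8 / 5 * \<gamma>\<^sup>2 * \<sigma>\<^sup>2) / (33 / 50 * \<gamma>)"
    unfolding w_def using \<gamma> \<mu> a1 M
    by (intro delayed_recursion[where p = "4 / 5 * \<gamma>" and r = "12 * L\<^sup>2 * \<gamma>^3 * (\<tau> + M)" and \<tau> = \<tau>
          and V = "\<lambda>t. \<integral>\<omega>. (norm (virtual t \<omega> - xstar))\<^sup>2 \<partial>\<Omega>"]
        quasi_convex_recursion[OF qc \<mu>] gap_nonneg T) auto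
  then show "(\<Sum>t<T. w t / (\<Sum>s<T. w s) * (\<integral>\<omega>. f (x t \<omega>) - fstar \<partial>\<Omega>))
    \<le> ((norm (x0 - xstar))\<^sup>2 / (\<Sum>t<T. w (Suc t)) + 8 / 5 * \<gamma>\<^sup>2 * \<sigma>\<^sup>2) / (33 / 50 * \<gamma>)"
    by (simp add: virtual_def prob_space)
qed

lemma nonconvex_rate:
  assumes T: "1 \<le> T"
  shows "(\<Sum>t<T. 1 / real T * (\<integral>\<omega>. (norm (gradf (x t \<omega>)))\<^sup>2 \<partial>\<Omega>))
    \<le> ((f x0 - fstar) / T + 3 / 5 * L * \<gamma>\<^sup>2 * \<sigma>\<^sup>2) / (11 / 25 * \<gamma>)"
proof -
  define u where "u = L * \<gamma> * \<tau>"
  define v where "v = L * \<gamma> * (\<tau> + M)"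
  have u0: "0 \<le> u" using L \<gamma> by (simp add: u_def)
  have u: "u \<le> v" unfolding u_def v_def using L \<gamma> M by (intro mult_left_mono) auto
  have v: "v \<le> 1 / 10" using \<gamma>_delay by (simp add: v_def)
  have uv: "u * v \<le> 1 / 10 * (1 / 10)" using u v u0 by (intro mult_mono) auto
  have "L\<^sup>2 * \<gamma>^3 * (\<tau> + M) * \<tau> = \<gamma> * (u * v)"
    by (simp add: u_def v_def power2_eq_square power3_eq_cube)
  moreover have "\<gamma> * (u * v) \<le> \<gamma> * (1 / 10 * (1 / 10))"
    using uv \<gamma>(1) by (intro mult_left_mono) auto
  ultimately have "11 / 25 * \<gamma> + L\<^sup>2 * \<gamma>^3 * (\<tau> + M) * \<tau> \<le> 9 / 20 * \<gamma>"
    using \<gamma>(1) by linarith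
  \<comment> \<open>The value \<open>11 / 25\<close> is exactly \<open>9 / 20 - 1 / 100\<close>. The
    powers of \<open>inverse (1 - 0)\<close> only match the shape of
    \<open>delayed_recursion\<close> at \<open>a = 0\<close> and simplify to 1.\<close>
  then have "11 / 25 * \<gamma> + L\<^sup>2 * \<gamma>^3 * (\<tau> + M) * \<tau> * inverse (1 - 0) ^ \<tau> \<le> 9 / 20 * \<gamma>"
    by simp
  then have "(\<Sum>t<T. inverse (1 - 0) ^ t / (\<Sum>s<T. inverse (1 - 0) ^ s) * (\<integral>\<omega>. (norm (gradf (x t \<omega>)))\<^sup>2 \<partial>\<Omega>))
    \<le> ((\<integral>\<omega>. f (virtual 0 \<omega>) - fstar \<partial>\<Omega>) / (\<Sum>t<T. inverse (1 - 0) ^ Suc t) + 3 / 5 * L * \<gamma>\<^sup>2 * \<sigma>\<^sup>2) / (11 / 25 * \<gamma>)"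
    using \<gamma> M lower_bound nonconvex_recursion
    by (intro delayed_recursion[where p = "9 / 20 * \<gamma>" and r = "L\<^sup>2 * \<gamma>^3 * (\<tau> + M)" and \<tau> = \<tau>
          and V = "\<lambda>t. \<integral>\<omega>. f (virtual t \<omega>) - fstar \<partial>\<Omega>"] T) auto
  then show ?thesis by (simp add: virtual_def prob_space)
qed

text \<open>Split over the events \<open>N = t\<close>. Each \<open>x t\<close> is measurable with
  respect to the noise sequence, of which \<open>N\<close> is independent, so every summand
  factors.\<close>

lemma output_expectation:
  assumes out: "output_index \<Omega> \<xi> w T N" and \<phi>: "\<phi> \<in> borel_measurable borel"
    and int: "\<And>t. integrable \<Omega> (\<lambda>\<omega>. \<phi> (x t \<omega>) :: real)"
  shows "integrable \<Omega> (\<lambda>\<omega>. \<phi> (x (N \<omega>) \<omega>))"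
    and "(\<integral>\<omega>. \<phi> (x (N \<omega>) \<omega>) \<partial>\<Omega>) = (\<Sum>t<T. w t / (\<Sum>s<T. w s) * (\<integral>\<omega>. \<phi> (x t \<omega>) \<partial>\<Omega>))"
proof -
  let ?S = "vimage_algebra (space \<Omega>) (\<lambda>\<omega> t. \<xi> t \<omega>) (\<Pi>\<^sub>M t\<in>UNIV. (borel :: 'a measure))"
  define A where "A = (\<lambda>t. N -` {t} \<inter> space \<Omega>)"
  have N[measurable]: "N \<in> measurable \<Omega> (count_space UNIV)"
    and indep: "indep_set (sets (vimage_algebra (space \<Omega>) N (count_space UNIV))) (sets ?S)"
    and less: "\<And>\<omega>. \<omega> \<in> space \<Omega> \<Longrightarrow> N \<omega> < T"
    and prob_N: "\<And>t. t < T \<Longrightarrow> prob {\<omega> \<in> space \<Omega>. N \<omega> = t} = w t / (\<Sum>s<T. w s)"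
    using out by (auto simp: output_index_def)
  have A_sets: "A t \<in> sets (vimage_algebra (space \<Omega>) N (count_space UNIV))" for t
    unfolding A_def by (rule in_vimage_algebra) simp
  have AM: "A t \<in> sets \<Omega>" for t unfolding A_def by measurable
  have S_noise: "\<xi> s \<in> borel_measurable ?S" for s
  proof -
    have "(\<lambda>\<omega> t. \<xi> t \<omega>) \<in> measurable ?S (\<Pi>\<^sub>M t\<in>UNIV. (borel :: 'a measure))"
      by (intro measurable_vimage_algebra1) (auto simp: space_PiM)
    then have "(\<lambda>\<omega>. (\<lambda>t. \<xi> t \<omega>) s) \<in> borel_measurable ?S"
      by (rule measurable_compose) (auto intro: measurable_component_singleton)
    then show ?thesis by simp
  qed
  have sub: "subalgebra \<Omega> ?S"
    by (intro subalgebra_vimage_algebra measurable_PiM_single' noise_measurable) auto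
  have term_int: "integrable \<Omega> (\<lambda>\<omega>. \<phi> (x t \<omega>) * indicator (A t) \<omega>)" for t
    using integrable_mult_indicator[OF AM int] by (simp add: mult.commute)
  have term_eq: "(\<integral>\<omega>. \<phi> (x t \<omega>) * indicator (A t) \<omega> \<partial>\<Omega>) = w t / (\<Sum>s<T. w s) * (\<integral>\<omega>. \<phi> (x t \<omega>) \<partial>\<Omega>)"
    if "t < T" for t
  proof -
    have "x t \<in> borel_measurable ?S" by (intro iterate_measurable_wrt S_noise) simp
    then have "(\<lambda>\<omega>. \<phi> (x t \<omega>)) \<in> borel_measurable ?S" using \<phi> by (rule measurable_compose)
    from indep_set_integral_indicator_mult[OF indep sub A_sets int this, of t]
    have "(\<integral>\<omega>. \<phi> (x t \<omega>) * indicator (A t) \<omega> \<partial>\<Omega>) = prob (A t) * (\<integral>\<omega>. \<phi> (x t \<omega>) \<partial>\<Omega>)" .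
    moreover have "A t = {\<omega> \<in> space \<Omega>. N \<omega> = t}" by (auto simp: A_def)
    ultimately show ?thesis using prob_N[OF that] by simp
  qed
  have eq: "\<phi> (x (N \<omega>) \<omega>) = (\<Sum>t<T. \<phi> (x t \<omega>) * indicator (A t) \<omega>)" if "\<omega> \<in> space \<Omega>" for \<omega>
  proof -
    have "(\<Sum>t<T. \<phi> (x t \<omega>) * indicator (A t) \<omega>) = (\<Sum>t<T. if t = N \<omega> then \<phi> (x t \<omega>) else 0)"
      using that by (intro sum.cong) (auto simp: A_def)
    then show ?thesis using less[OF that] by simp
  qed
  have "integrable \<Omega> (\<lambda>\<omega>. \<Sum>t<T. \<phi> (x t \<omega>) * indicator (A t) \<omega>)"
    by (intro Bochner_Integration.integrable_sum term_int)
  then show "integrable \<Omega> (\<lambda>\<omega>. \<phi> (x (N \<omega>) \<omega>))"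
    using eq by (subst Bochner_Integration.integrable_cong[OF refl]) auto
  have "(\<integral>\<omega>. \<phi> (x (N \<omega>) \<omega>) \<partial>\<Omega>) = (\<integral>\<omega>. (\<Sum>t<T. \<phi> (x t \<omega>) * indicator (A t) \<omega>) \<partial>\<Omega>)"
    using eq by (intro Bochner_Integration.integral_cong) auto
  also have "\<dots> = (\<Sum>t<T. w t / (\<Sum>s<T. w s) * (\<integral>\<omega>. \<phi> (x t \<omega>) \<partial>\<Omega>))"
    unfolding Bochner_Integration.integral_sum[OF term_int]
    by (rule sum.cong[OF refl], rule term_eq) simp
  finally show "(\<integral>\<omega>. \<phi> (x (N \<omega>) \<omega>) \<partial>\<Omega>) = (\<Sum>t<T. w t / (\<Sum>s<T. w s) * (\<integral>\<omega>. \<phi> (x t \<omega>) \<partial>\<Omega>))" .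
qed

lemma output_gap:
  assumes out: "output_index \<Omega> \<xi> w T N" and W: "(\<Sum>s<T. w s) \<noteq> 0"
  shows "integrable \<Omega> (\<lambda>\<omega>. f (x (N \<omega>) \<omega>))"
    and "(\<integral>\<omega>. f (x (N \<omega>) \<omega>) \<partial>\<Omega>) - fstar
      = (\<Sum>t<T. w t / (\<Sum>s<T. w s) * (\<integral>\<omega>. f (x t \<omega>) - fstar \<partial>\<Omega>))"
proof -
  note int = integrable_f[OF square_integrable_iterate]
  show "integrable \<Omega> (\<lambda>\<omega>. f (x (N \<omega>) \<omega>))"
    by (rule output_expectation(1)[OF out borel_measurable_f int])
  have "(\<Sum>t<T. w t / (\<Sum>s<T. w s) * fstar) = fstar"
    using W by (simp add: sum_distrib_right[symmetric] sum_divide_distrib[symmetric])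
  then show "(\<integral>\<omega>. f (x (N \<omega>) \<omega>) \<partial>\<Omega>) - fstar
      = (\<Sum>t<T. w t / (\<Sum>s<T. w s) * (\<integral>\<omega>. f (x t \<omega>) - fstar \<partial>\<Omega>))"
    unfolding output_expectation(2)[OF out borel_measurable_f int]
    using int by (simp add: prob_space right_diff_distrib sum_subtractf)
qed

end

subsection \<open>Tuning the stepsize\<close>

lemma tuning_log_ge_half: "1 / 2 \<le> tuning_log a c r T"
proof -
  have "ln 2 \<le> tuning_log a c r T" unfolding tuning_log_def by (subst ln_le_cancel_iff) auto
  then show ?thesis using ln2_ge_two_thirds by simp
qed

lemma stepsize_A_bounds:
  assumes "0 < d" "0 < a" "1 \<le> T"
  shows "0 < stepsize_A d a c r T" "stepsize_A d a c r T \<le> 1 / d"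
  using assms tuning_log_ge_half[of a c r T] by (auto simp: stepsize_A_def)

text \<open>The stepsize is at most \<open>l / (a * T)\<close> unless \<open>c = 0\<close>, which
  settles the noise term. The initial term is \<open>E\<close> at the cap; below it the logarithm is
  chosen so that the exponential is at most \<open>1 / B\<close>, turning this term into a multiple
  of \<open>C\<close>.\<close>

lemma tuning_A:
  assumes d: "0 < d" and a: "0 < a" and c: "0 \<le> c" and r: "0 \<le> r" and T: "1 \<le> T"
  defines "\<gamma> \<equiv> stepsize_A d a c r T" and "l \<equiv> tuning_log a c r T"
  shows "(r * exp (- (a * \<gamma> * T)) + 8 / 5 * \<gamma>\<^sup>2 * c) / (33 / 50 * \<gamma>)
    \<le> 10 * l * (d * r * exp (- (a * T / d)) + c / (a * T))"
proof -
  have l: "1 / 2 \<le> l" unfolding l_def by (rule tuning_log_ge_half)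
  have \<gamma>: "0 < \<gamma>" unfolding \<gamma>_def using stepsize_A_bounds d a T by simp
  define E where "E = d * r * exp (- (a * T / d))"
  define C where "C = c / (a * T)"
  have E0: "0 \<le> E" and C0: "0 \<le> C" using assms by (auto simp: E_def C_def)
  have lE: "1 / 2 * E \<le> l * E" and lC: "0 \<le> l * C"
    using l E0 C0 mult_right_mono[OF l E0] by auto
  have noise: "c * \<gamma> \<le> l * C"
  proof (cases "c = 0")
    case False
    then have "\<gamma> \<le> l / (a * T)" by (simp add: \<gamma>_def l_def stepsize_A_def)
    from mult_left_mono[OF this c] show ?thesis by (simp add: C_def ac_simps)
  qed (simp add: C_def)
  define P where "P = r * exp (- (a * \<gamma> * T)) / \<gamma>"
  have split: "(r * exp (- (a * \<gamma> * T)) + 8 / 5 * \<gamma>\<^sup>2 * c) / (33 / 50 * \<gamma>)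
      = 50 / 33 * P + 80 / 33 * (c * \<gamma>)"
    using \<gamma> by (simp add: P_def field_simps power2_eq_square)
  have "P \<le> 2 * (l * E) + 4 * (l * C)"
  proof (cases "\<gamma> = 1 / d")
    case True
    then have "P = E" by (simp add: P_def E_def mult.commute)
    then show ?thesis using lE lC by linarith
  next
    case False
    then have c': "c \<noteq> 0" and \<gamma>_eq: "\<gamma> = l / (a * T)"
      by (auto simp: \<gamma>_def l_def stepsize_A_def min_def split: if_splits)
    show ?thesis
    \<comment> \<open>For \<open>r = 0\<close> the ratio \<open>B\<close> would vanish and
      \<open>inverse B\<close> would no longer bound the exponential.\<close>
    proof (cases "r = 0")
      case True
      then show ?thesis using lE lC E0 by (simp add: P_def)
    next
      case False
      define B where "B = a\<^sup>2 * r * (real T)\<^sup>2 / c"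
      have B: "0 < B" unfolding B_def using a r c c' False T by simp
      have "exp (- (a * \<gamma> * T)) = inverse (max 2 B)"
        using a T by (simp add: \<gamma>_eq l_def tuning_log_def B_def[symmetric] exp_minus)
      also have "\<dots> \<le> inverse B" using B by (intro le_imp_inverse_le) auto
      finally have "P \<le> r * inverse B / \<gamma>"
        unfolding P_def using r \<gamma> by (intro divide_right_mono mult_left_mono) auto
      also have "\<dots> = C * (1 / l)"
        using a r c c' False T l by (simp add: B_def C_def \<gamma>_eq field_simps power2_eq_square)
      also have "\<dots> \<le> C * (4 * l)"
      proof (rule mult_left_mono[OF _ C0])
        have "1 / 2 * (1 / 2) \<le> l * l" using l by (intro mult_mono) auto
        then show "1 / l \<le> 4 * l" using l by (simp add: field_simps)
      qed
      finally show ?thesis using lE E0 by (simp add: mult_ac)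
    qed
  qed
  then have "(r * exp (- (a * \<gamma> * T)) + 8 / 5 * \<gamma>\<^sup>2 * c) / (33 / 50 * \<gamma>)
      \<le> 10 * (l * E) + 10 * (l * C)"
    unfolding split using noise lE lC E0 by linarith
  then show ?thesis by (simp add: E_def C_def algebra_simps)
qed

lemma stepsize_B_bounds:
  assumes "0 \<le> d" "0 \<le> c" "0 \<le> r"
  shows "0 \<le> stepsize_B d c r T" "stepsize_B d c r T \<le> 1 / d"
  using assms by (auto simp: stepsize_B_def)

lemma stepsize_B_eq_0:
  assumes "stepsize_B d c r T = 0" "0 < d" "1 \<le> T"
  shows "r = 0"
  using assms by (auto simp: stepsize_B_def split: if_splits)

text \<open>The uncapped stepsize equalizes the two terms, and both are then
  \<open>sqrt (c * r / T)\<close>. At the cap the first term is \<open>d * r / T\<close>, and the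
  second can only be smaller than at the uncapped value.\<close>

lemma tuning_B:
  assumes d: "0 < d" and c: "0 \<le> c" and r: "0 \<le> r" and T: "1 \<le> T"
  defines "\<gamma> \<equiv> stepsize_B d c r T"
  assumes \<gamma>: "0 < \<gamma>"
  shows "r / T / \<gamma> \<le> d * r / T + sqrt (c * r / T)" and "c * \<gamma> \<le> sqrt (c * r / T)"
proof -
  have opt: "c * sqrt (r / (c * T)) = sqrt (c * r / T)"
  proof -
    have "c * sqrt (r / (c * T)) = sqrt (c\<^sup>2 * (r / (c * T)))"
      using c by (simp only: real_sqrt_mult real_sqrt_abs abs_of_nonneg)
    also have "c\<^sup>2 * (r / (c * T)) = c * r / T" by (simp add: power2_eq_square)
    finally show ?thesis .
  qed
  have s0: "0 \<le> sqrt (c * r / T)" and dr: "0 \<le> d * r / T" using c r d by auto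
  show "c * \<gamma> \<le> sqrt (c * r / T)"
    unfolding opt[symmetric] using c
    by (cases "c = 0") (auto simp: \<gamma>_def stepsize_B_def intro!: mult_left_mono)
  show "r / T / \<gamma> \<le> d * r / T + sqrt (c * r / T)"
  proof (cases "\<gamma> = 1 / d")
    case True
    then show ?thesis using s0 by (simp add: mult.commute)
  next
    case False
    then have c': "c \<noteq> 0" and eq: "\<gamma> = sqrt (r / (c * T))"
      by (auto simp: \<gamma>_def stepsize_B_def split: if_splits)
    have "\<gamma> * \<gamma> = r / (c * T)" using c r by (simp add: eq)
    then have "r / T = c * \<gamma> * \<gamma>" using c' by (simp add: mult.assoc)
    then have "r / T / \<gamma> = c * \<gamma>" using \<gamma> by simp
    then show ?thesis using opt dr by (simp add: eq)
  qed
qed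

lemma delayed_sgd_stepsize_0:
  assumes run: "delayed_sgd \<Omega> gradf M \<sigma> \<tau> 0 x0 x \<xi>"
  shows "integrable \<Omega> (\<lambda>\<omega>. \<phi> (x (N \<omega>) \<omega>) :: real)" and "(\<integral>\<omega>. \<phi> (x (N \<omega>) \<omega>) \<partial>\<Omega>) = \<phi> x0"
proof -
  interpret prob_space \<Omega> using run by (simp add: delayed_sgd_def)
  have x: "x t \<omega> = x0" if "\<omega> \<in> space \<Omega>" for t \<omega>
  proof (induction t)
    case (Suc t)
    then show ?case using run that by (cases "\<tau> \<le> t") (auto simp: delayed_sgd_def)
  qed (use run that in \<open>auto simp: delayed_sgd_def\<close>)
  show "integrable \<Omega> (\<lambda>\<omega>. \<phi> (x (N \<omega>) \<omega>))"
    using x by (subst Bochner_Integration.integrable_cong[OF refl, where g = "\<lambda>_. \<phi> x0"]) auto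
  show "(\<integral>\<omega>. \<phi> (x (N \<omega>) \<omega>) \<partial>\<Omega>) = \<phi> x0"
    using x by (subst Bochner_Integration.integral_cong[OF refl, where g = "\<lambda>_. \<phi> x0"])
      (auto simp: prob_space)
qed

theorem theorem16:
  fixes f :: "'a::euclidean_space \<Rightarrow> real" and gradf :: "'a \<Rightarrow> 'a"
    and fstar L M \<sigma> :: real and \<tau> T :: nat and x0 :: 'a
  assumes gradient: "\<And>x. GDERIV f x :> gradf x"
    and minimum: "\<And>x. fstar \<le> f x" "\<exists>x. f x = fstar"
    and smooth: "\<And>x y. norm (gradf x - gradf y) \<le> L * norm (x - y)"
    and "1 \<le> \<tau>" "0 \<le> M" "0 \<le> \<sigma>" "1 \<le> T"
  shows
    "(\<forall>(\<mu>::real) xstar. 0 < \<mu> \<and> quasi_convex f gradf fstar \<mu> xstar \<longrightarrow>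
       (\<exists>\<gamma>. 0 < \<gamma> \<and> \<gamma> \<le> 1 / (10 * L * (\<tau> + M)) \<and>
          \<gamma> = stepsize_A (10 * L * (\<tau> + M)) (\<mu> / 2) (\<sigma>\<^sup>2) ((norm (x0 - xstar))\<^sup>2) T \<and>
          (\<forall>(\<Omega> :: 'w measure) x \<xi> N.
             delayed_sgd \<Omega> gradf M \<sigma> \<tau> \<gamma> x0 x \<xi> \<and>
             output_index \<Omega> \<xi> (\<lambda>t. (1 - \<mu> * \<gamma> / 2) powi (- int t)) T N \<longrightarrow>
             integrable \<Omega> (\<lambda>\<omega>. f (x (N \<omega>) \<omega>)) \<and>
             (\<integral>\<omega>. f (x (N \<omega>) \<omega>) \<partial>\<Omega>) - fstar
               \<le> 100 * tuning_log (\<mu> / 2) (\<sigma>\<^sup>2) ((norm (x0 - xstar))\<^sup>2) T *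
                   (L * (\<tau> + M) * (norm (x0 - xstar))\<^sup>2
                      * exp (- ((\<mu> / 2) * T / (10 * L * (\<tau> + M))))
                    + \<sigma>\<^sup>2 / (\<mu> * T)))))
     \<and>
     (\<forall>xstar. quasi_convex f gradf fstar 0 xstar \<longrightarrow>
       (\<exists>\<gamma>. 0 \<le> \<gamma> \<and> \<gamma> \<le> 1 / (10 * L * (\<tau> + M)) \<and>
          \<gamma> = stepsize_B (10 * L * (\<tau> + M)) (\<sigma>\<^sup>2) ((norm (x0 - xstar))\<^sup>2) T \<and>
          (\<forall>(\<Omega> :: 'w measure) x \<xi> N.
             delayed_sgd \<Omega> gradf M \<sigma> \<tau> \<gamma> x0 x \<xi> \<and> output_index \<Omega> \<xi> (\<lambda>t. 1) T N \<longrightarrow>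
             integrable \<Omega> (\<lambda>\<omega>. f (x (N \<omega>) \<omega>)) \<and>
             (\<integral>\<omega>. f (x (N \<omega>) \<omega>) \<partial>\<Omega>) - fstar
               \<le> 100 * (L * (\<tau> + M) * (norm (x0 - xstar))\<^sup>2 / T
                        + \<sigma> * norm (x0 - xstar) / sqrt T))))
     \<and>
     (\<exists>\<gamma>. 0 \<le> \<gamma> \<and> \<gamma> \<le> 1 / (10 * L * (\<tau> + M)) \<and>
        \<gamma> = stepsize_B (10 * L * (\<tau> + M)) (L * \<sigma>\<^sup>2) (f x0 - fstar) T \<and>
        (\<forall>(\<Omega> :: 'w measure) x \<xi> N.
           delayed_sgd \<Omega> gradf M \<sigma> \<tau> \<gamma> x0 x \<xi> \<and> output_index \<Omega> \<xi> (\<lambda>t. 1) T N \<longrightarrow>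
           integrable \<Omega> (\<lambda>\<omega>. (norm (gradf (x (N \<omega>) \<omega>)))\<^sup>2) \<and>
           (\<integral>\<omega>. (norm (gradf (x (N \<omega>) \<omega>)))\<^sup>2 \<partial>\<Omega>)
             \<le> 100 * (L * (\<tau> + M) * (f x0 - fstar) / T
                      + \<sigma> * sqrt (L * (f x0 - fstar) / T))))"
proof -
  interpret smooth_function f gradf fstar L
    using gradient minimum smooth by unfold_locales auto
  define d where "d = 10 * L * (\<tau> + M)"
  have d0: "0 \<le> d" and d_pos: "0 < L \<Longrightarrow> 0 < d"
    using smoothness_const_nonneg \<open>1 \<le> \<tau>\<close> \<open>0 \<le> M\<close> by (auto simp: d_def)
  have \<tau>M: "L * (\<tau> + M) = d / 10" by (simp add: d_def)
  have delayed_run: "delayed_run f gradf fstar L \<Omega> M \<sigma> \<gamma> \<tau> x0 x \<xi>"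
    if "delayed_sgd \<Omega> gradf M \<sigma> \<tau> \<gamma> x0 x \<xi>" "0 < L" "0 < \<gamma>" "\<gamma> \<le> 1 / d"
    for \<Omega> :: "'w measure" and \<gamma> x \<xi>
  proof -
    interpret prob_space \<Omega> using that(1) by (simp add: delayed_sgd_def)
    show ?thesis using that \<open>1 \<le> \<tau>\<close> \<open>0 \<le> M\<close> unfolding d_def by unfold_locales
  qed

  \<comment> \<open>Quasi-convex case with positive modulus\<close>
  have part1: "\<exists>\<gamma>. 0 < \<gamma> \<and> \<gamma> \<le> 1 / d \<and>
      \<gamma> = stepsize_A d (\<mu> / 2) (\<sigma>\<^sup>2) ((norm (x0 - xstar))\<^sup>2) T \<and>
      (\<forall>(\<Omega> :: 'w measure) x \<xi> N.
         delayed_sgd \<Omega> gradf M \<sigma> \<tau> \<gamma> x0 x \<xi> \<and>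
         output_index \<Omega> \<xi> (\<lambda>t. (1 - \<mu> * \<gamma> / 2) powi (- int t)) T N \<longrightarrow>
         integrable \<Omega> (\<lambda>\<omega>. f (x (N \<omega>) \<omega>)) \<and>
         (\<integral>\<omega>. f (x (N \<omega>) \<omega>) \<partial>\<Omega>) - fstar
           \<le> 100 * tuning_log (\<mu> / 2) (\<sigma>\<^sup>2) ((norm (x0 - xstar))\<^sup>2) T *
               (d / 10 * (norm (x0 - xstar))\<^sup>2 * exp (- ((\<mu> / 2) * T / d)) + \<sigma>\<^sup>2 / (\<mu> * T)))"
    if \<mu>: "0 < \<mu>" and qc: "quasi_convex f gradf fstar \<mu> xstar" for \<mu> xstar
  proof -
    \<comment> \<open>For \<open>L = 0\<close> all gradients vanish, and quasi-convexity at a point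
      other than \<open>xstar\<close> would make a positive number nonpositive. Hence the cap is a
      genuine positive stepsize.\<close>
    have "L \<noteq> 0"
    proof
      assume "L = 0"
      obtain b :: 'a where "b \<in> Basis" using nonempty_Basis by blast
      then show False
        using qc \<mu> lower_bound[of "xstar + b"] gradient_zero[of "xstar + b"] \<open>L = 0\<close>
        by (auto simp: quasi_convex_def dest!: spec[of _ "xstar + b"])
    qed
    then have L: "0 < L" using smoothness_const_nonneg by simp
    define r where "r = (norm (x0 - xstar))\<^sup>2"
    define l where "l = tuning_log (\<mu> / 2) (\<sigma>\<^sup>2) r T"
    define \<gamma> where "\<gamma> = stepsize_A d (\<mu> / 2) (\<sigma>\<^sup>2) r T"
    have \<gamma>: "0 < \<gamma>" "\<gamma> \<le> 1 / d"
      unfolding \<gamma>_def using d_pos[OF L] \<mu> \<open>1 \<le> T\<close> by (auto intro: stepsize_A_bounds)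
    have "integrable \<Omega> (\<lambda>\<omega>. f (x (N \<omega>) \<omega>)) \<and>
        (\<integral>\<omega>. f (x (N \<omega>) \<omega>) \<partial>\<Omega>) - fstar
          \<le> 100 * l * (d / 10 * r * exp (- ((\<mu> / 2) * T / d)) + \<sigma>\<^sup>2 / (\<mu> * T))"
      if run: "delayed_sgd \<Omega> gradf M \<sigma> \<tau> \<gamma> x0 x \<xi>"
        and out: "output_index \<Omega> \<xi> (\<lambda>t. (1 - \<mu> * \<gamma> / 2) powi (- int t)) T N"
      for \<Omega> :: "'w measure" and x \<xi> N
    proof -
      interpret delayed_run f gradf fstar L \<Omega> M \<sigma> \<gamma> \<tau> x0 x \<xi>
        by (rule delayed_run[OF run L \<gamma>])
      define w where "w = (\<lambda>t. inverse (1 - \<mu> * \<gamma> / 2) ^ t)"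
      have "(\<lambda>t. (1 - \<mu> * \<gamma> / 2) powi (- int t)) = w"
        by (simp add: w_def power_int_minus power_inverse)
      with out have out: "output_index \<Omega> \<xi> w T N" by simp
      have a: "\<mu> * \<gamma> / 2 < 1" using quasi_convex_rate(2)[OF qc _ \<open>1 \<le> T\<close>] \<mu> by simp
      then have w0: "0 < w t" for t by (simp add: w_def)
      have W0: "0 < (\<Sum>s<T. w s)"
        using w0 \<open>1 \<le> T\<close> by (intro sum_pos) (auto simp: lessThan_empty_iff)
      \<comment> \<open>Keeping only the last weight already gives the exponential decay of the
        initial term.\<close>
      have weight: "exp (\<mu> / 2 * \<gamma> * T) \<le> (\<Sum>t<T. w (Suc t))"
      proof -
        have "1 - \<mu> * \<gamma> / 2 \<le> exp (- (\<mu> * \<gamma> / 2))"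
          using exp_ge_add_one_self[of "- (\<mu> * \<gamma> / 2)"] by simp
        then have "inverse (exp (- (\<mu> * \<gamma> / 2))) \<le> inverse (1 - \<mu> * \<gamma> / 2)"
          using a by (intro le_imp_inverse_le) auto
        then have "exp (\<mu> * \<gamma> / 2) ^ T \<le> w T"
          unfolding w_def by (intro power_mono) (auto simp: exp_minus)
        also have "w T = w (Suc (T - 1))" using \<open>1 \<le> T\<close> by simp
        also have "\<dots> \<le> (\<Sum>t<T. w (Suc t))"
          using \<open>1 \<le> T\<close> by (intro member_le_sum less_imp_le[OF w0]) auto
        finally show ?thesis by (simp add: exp_of_nat_mult[symmetric] mult_ac)
      qed
      have "(\<integral>\<omega>. f (x (N \<omega>) \<omega>) \<partial>\<Omega>) - fstar
          \<le> (r / (\<Sum>t<T. w (Suc t)) + 8 / 5 * \<gamma>\<^sup>2 * \<sigma>\<^sup>2) / (33 / 50 * \<gamma>)"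
        unfolding output_gap(2)[OF out W0[THEN less_imp_neq, symmetric]] r_def w_def
        using \<mu> by (intro quasi_convex_rate(1)[OF qc _ \<open>1 \<le> T\<close>]) simp
      also have "\<dots> \<le> (r / exp (\<mu> / 2 * \<gamma> * T) + 8 / 5 * \<gamma>\<^sup>2 * \<sigma>\<^sup>2) / (33 / 50 * \<gamma>)"
        using \<gamma> weight by (intro divide_right_mono add_right_mono divide_left_mono)
          (auto simp: r_def intro!: mult_pos_pos less_le_trans[OF exp_gt_zero weight])
      also have "\<dots> = (r * exp (- (\<mu> / 2 * \<gamma> * T)) + 8 / 5 * \<gamma>\<^sup>2 * \<sigma>\<^sup>2) / (33 / 50 * \<gamma>)"
        by (simp only: exp_minus divide_inverse)
      also have "\<dots> \<le> 10 * l * (d * r * exp (- (\<mu> / 2 * T / d)) + \<sigma>\<^sup>2 / (\<mu> / 2 * T))"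
        unfolding \<gamma>_def l_def using \<mu> d_pos[OF L] \<open>1 \<le> T\<close>
        by (intro tuning_A) (auto simp: r_def)
      \<comment> \<open>The noise term was formed with \<open>a = \<mu> / 2\<close>, so its
        coefficient \<open>10 * 2\<close> is rewritten as \<open>100 / 5\<close>.\<close>
      also have "\<dots> = 100 * l * (d / 10 * r * exp (- (\<mu> / 2 * T / d)) + \<sigma>\<^sup>2 / (\<mu> * T) / 5)"
        by (simp add: algebra_simps)
      also have "\<dots> \<le> 100 * l * (d / 10 * r * exp (- (\<mu> / 2 * T / d)) + \<sigma>\<^sup>2 / (\<mu> * T))"
      proof -
        have fifth: "y / 5 \<le> y" if "0 \<le> y" for y :: real using that by simp
        have "\<sigma>\<^sup>2 / (\<mu> * T) / 5 \<le> \<sigma>\<^sup>2 / (\<mu> * T)"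
          by (rule fifth) (use \<mu> in simp)
        moreover have "0 \<le> 100 * l"
          using tuning_log_ge_half[of "\<mu> / 2" "\<sigma>\<^sup>2" r T] by (simp add: l_def)
        ultimately show ?thesis by (intro mult_left_mono add_left_mono)
      qed
      finally show ?thesis using output_gap(1)[OF out] W0 by simp
    qed
    then show ?thesis
      using \<gamma> unfolding r_def[symmetric] \<gamma>_def[symmetric] l_def[symmetric]
      by (intro exI[of _ \<gamma>]) blast
  qed

  \<comment> \<open>Quasi-convex case with zero modulus\<close>
  have part2: "\<exists>\<gamma>. 0 \<le> \<gamma> \<and> \<gamma> \<le> 1 / d \<and>
      \<gamma> = stepsize_B d (\<sigma>\<^sup>2) ((norm (x0 - xstar))\<^sup>2) T \<and>
      (\<forall>(\<Omega> :: 'w measure) x \<xi> N.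
         delayed_sgd \<Omega> gradf M \<sigma> \<tau> \<gamma> x0 x \<xi> \<and> output_index \<Omega> \<xi> (\<lambda>t. 1) T N \<longrightarrow>
         integrable \<Omega> (\<lambda>\<omega>. f (x (N \<omega>) \<omega>)) \<and>
         (\<integral>\<omega>. f (x (N \<omega>) \<omega>) \<partial>\<Omega>) - fstar
           \<le> 100 * (d / 10 * (norm (x0 - xstar))\<^sup>2 / T + \<sigma> * norm (x0 - xstar) / sqrt T))"
    if qc: "quasi_convex f gradf fstar 0 xstar" for xstar
  proof -
    define r where "r = (norm (x0 - xstar))\<^sup>2"
    define \<gamma> where "\<gamma> = stepsize_B d (\<sigma>\<^sup>2) r T"
    have \<gamma>: "0 \<le> \<gamma>" "\<gamma> \<le> 1 / d"
      unfolding \<gamma>_def r_def using d0 by (auto intro: stepsize_B_bounds)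
    define s where "s = \<sigma> * norm (x0 - xstar) / sqrt T"
    have s: "sqrt (\<sigma>\<^sup>2 * r / T) = s"
      using \<open>0 \<le> \<sigma>\<close> by (simp add: s_def r_def real_sqrt_mult real_sqrt_divide)
    define D where "D = d * r / T"
    have s0: "0 \<le> s" and D0: "0 \<le> D"
      using \<open>0 \<le> \<sigma>\<close> d0 by (auto simp: s_def r_def D_def)
    have "integrable \<Omega> (\<lambda>\<omega>. f (x (N \<omega>) \<omega>)) \<and>
        (\<integral>\<omega>. f (x (N \<omega>) \<omega>) \<partial>\<Omega>) - fstar \<le> 100 * (d / 10 * r / T + s)"
      if run: "delayed_sgd \<Omega> gradf M \<sigma> \<tau> \<gamma> x0 x \<xi>" and out: "output_index \<Omega> \<xi> (\<lambda>t. 1) T N"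
      for \<Omega> :: "'w measure" and x \<xi> N
    proof (cases "\<gamma> = 0")
      case True
      \<comment> \<open>If \<open>L > 0\<close> then \<open>d > 0\<close>, and a zero stepsize
        forces \<open>r = 0\<close>. In either case the right-hand side of quasi-convexity at
        \<open>x0\<close> is 0, so \<open>x0\<close> is a minimizer and the constant run is
        optimal.\<close>
      have "L = 0 \<or> r = 0"
        using stepsize_B_eq_0[of d "\<sigma>\<^sup>2" r T] True d_pos smoothness_const_nonneg \<open>1 \<le> T\<close>
        by (force simp: \<gamma>_def)
      then have "f x0 \<le> fstar"
        using qc gradient_zero[of x0] by (auto simp: quasi_convex_def r_def dest!: spec[of _ x0])
      then show ?thesis
        using delayed_sgd_stepsize_0[of \<Omega> gradf M \<sigma> \<tau> x0 x \<xi> f N] run True s0 D0 by (auto simp: D_def)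
    next
      case False
      then have \<gamma>': "0 < \<gamma>" using \<gamma> by simp
      then have "d \<noteq> 0" using \<gamma> by auto
      then have L: "0 < L" using smoothness_const_nonneg by (auto simp: d_def less_le)
      interpret delayed_run f gradf fstar L \<Omega> M \<sigma> \<gamma> \<tau> x0 x \<xi>
        by (rule delayed_run[OF run L \<gamma>' \<gamma>(2)])
      have "(\<integral>\<omega>. f (x (N \<omega>) \<omega>) \<partial>\<Omega>) - fstar \<le> (r / T + 8 / 5 * \<gamma>\<^sup>2 * \<sigma>\<^sup>2) / (33 / 50 * \<gamma>)"
        using output_gap(2)[OF out] quasi_convex_rate(1)[OF qc order_refl \<open>1 \<le> T\<close>] \<open>1 \<le> T\<close>
        by (simp add: r_def)
      also have "\<dots> = 50 / 33 * (r / T / \<gamma>) + 80 / 33 * (\<sigma>\<^sup>2 * \<gamma>)"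
        using \<gamma>' by (simp add: field_simps power2_eq_square)
      also have "\<dots> \<le> 50 / 33 * (D + s) + 80 / 33 * s"
        using tuning_B[of d "\<sigma>\<^sup>2" r T] \<open>d \<noteq> 0\<close> d0 \<gamma>' \<open>1 \<le> T\<close>
        unfolding \<gamma>_def[symmetric] s D_def[symmetric] by (intro add_mono mult_left_mono) (auto simp: r_def)
      also have "\<dots> \<le> 10 * D + 100 * s"
        unfolding distrib_left using s0 D0 by linarith
      finally show ?thesis using output_gap(1)[OF out] \<open>1 \<le> T\<close> by (simp add: D_def)
    qed
    then show ?thesis
      using \<gamma> unfolding r_def[symmetric] \<gamma>_def[symmetric] s_def[symmetric]
      by (intro exI[of _ \<gamma>]) blast
  qed

  \<comment> \<open>Non-convex case\<close>
  have part3: "\<exists>\<gamma>. 0 \<le> \<gamma> \<and> \<gamma> \<le> 1 / d \<and>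
      \<gamma> = stepsize_B d (L * \<sigma>\<^sup>2) (f x0 - fstar) T \<and>
      (\<forall>(\<Omega> :: 'w measure) x \<xi> N.
         delayed_sgd \<Omega> gradf M \<sigma> \<tau> \<gamma> x0 x \<xi> \<and> output_index \<Omega> \<xi> (\<lambda>t. 1) T N \<longrightarrow>
         integrable \<Omega> (\<lambda>\<omega>. (norm (gradf (x (N \<omega>) \<omega>)))\<^sup>2) \<and>
         (\<integral>\<omega>. (norm (gradf (x (N \<omega>) \<omega>)))\<^sup>2 \<partial>\<Omega>)
           \<le> 100 * (d / 10 * (f x0 - fstar) / T + \<sigma> * sqrt (L * (f x0 - fstar) / T)))"
  proof -
    define r where "r = f x0 - fstar"
    have r0: "0 \<le> r" using lower_bound by (simp add: r_def)
    define \<gamma> where "\<gamma> = stepsize_B d (L * \<sigma>\<^sup>2) r T"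
    have \<gamma>: "0 \<le> \<gamma>" "\<gamma> \<le> 1 / d"
      unfolding \<gamma>_def using d0 r0 smoothness_const_nonneg by (auto intro: stepsize_B_bounds)
    define s where "s = \<sigma> * sqrt (L * r / T)"
    have s: "sqrt (L * \<sigma>\<^sup>2 * r / T) = s"
    proof -
      have "sqrt (L * \<sigma>\<^sup>2 * r / T) = sqrt (\<sigma>\<^sup>2 * (L * r / T))" by (simp add: ac_simps)
      also have "\<dots> = s" unfolding s_def using \<open>0 \<le> \<sigma>\<close> by (simp only: real_sqrt_mult real_sqrt_abs abs_of_nonneg)
      finally show ?thesis .
    qed
    define D where "D = d * r / T"
    have s0: "0 \<le> s" and D0: "0 \<le> D"
      using \<open>0 \<le> \<sigma>\<close> d0 r0 smoothness_const_nonneg by (auto simp: s_def D_def)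
    have "integrable \<Omega> (\<lambda>\<omega>. (norm (gradf (x (N \<omega>) \<omega>)))\<^sup>2) \<and>
        (\<integral>\<omega>. (norm (gradf (x (N \<omega>) \<omega>)))\<^sup>2 \<partial>\<Omega>) \<le> 100 * (d / 10 * r / T + s)"
      if run: "delayed_sgd \<Omega> gradf M \<sigma> \<tau> \<gamma> x0 x \<xi>" and out: "output_index \<Omega> \<xi> (\<lambda>t. 1) T N"
      for \<Omega> :: "'w measure" and x \<xi> N
    proof (cases "\<gamma> = 0")
      case True
      \<comment> \<open>Both alternatives make \<open>x0\<close> stationary, so a run that never
        moves has squared gradient 0.\<close>
      have "f x0 = fstar \<or> L = 0"
        using stepsize_B_eq_0[of d "L * \<sigma>\<^sup>2" r T] True d_pos smoothness_const_nonneg \<open>1 \<le> T\<close>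
        by (force simp: \<gamma>_def r_def)
      then have "gradf x0 = 0" by (rule gradient_zero)
      then show ?thesis
        using delayed_sgd_stepsize_0[of \<Omega> gradf M \<sigma> \<tau> x0 x \<xi> "\<lambda>y. (norm (gradf y))\<^sup>2" N] run True s0 D0
        by (auto simp: D_def)
    next
      case False
      then have \<gamma>': "0 < \<gamma>" using \<gamma> by simp
      then have "d \<noteq> 0" using \<gamma> by auto
      then have L: "0 < L" using smoothness_const_nonneg by (auto simp: d_def less_le)
      interpret delayed_run f gradf fstar L \<Omega> M \<sigma> \<gamma> \<tau> x0 x \<xi>
        by (rule delayed_run[OF run L \<gamma>' \<gamma>(2)])
      have meas: "(\<lambda>y. (norm (gradf y))\<^sup>2) \<in> borel_measurable borel" by measurable
      note out_eq = output_expectation[OF out meas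
          square_integrable_norm_sq[OF square_integrable_iterate_gradient]]
      have "(\<integral>\<omega>. (norm (gradf (x (N \<omega>) \<omega>)))\<^sup>2 \<partial>\<Omega>)
          \<le> (r / T + 3 / 5 * L * \<gamma>\<^sup>2 * \<sigma>\<^sup>2) / (11 / 25 * \<gamma>)"
        using out_eq(2) nonconvex_rate[OF \<open>1 \<le> T\<close>] by (simp add: r_def)
      also have "\<dots> = 25 / 11 * (r / T / \<gamma>) + 15 / 11 * (L * \<sigma>\<^sup>2 * \<gamma>)"
        using \<gamma>' by (simp add: field_simps power2_eq_square)
      also have "\<dots> \<le> 25 / 11 * (D + s) + 15 / 11 * s"
        using tuning_B[of d "L * \<sigma>\<^sup>2" r T] \<open>d \<noteq> 0\<close> d0 \<gamma>' r0 L \<open>1 \<le> T\<close>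
        unfolding \<gamma>_def[symmetric] s D_def[symmetric] by (intro add_mono mult_left_mono) auto
      also have "\<dots> \<le> 10 * D + 100 * s"
        unfolding distrib_left using s0 D0 by linarith
      finally show ?thesis using out_eq(1) by (simp add: D_def)
    qed
    then show ?thesis
      using \<gamma> unfolding r_def[symmetric] \<gamma>_def[symmetric] s_def[symmetric]
      by (intro exI[of _ \<gamma>]) blast
  qed
  show ?thesis
    unfolding \<tau>M d_def[symmetric] using part1 part2 part3 by blast
qed

end
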